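(* Let $X$ be an affine arrangement variety over $\mathbb{C}$. Any semi-canonical embedding of $X$ is well-poised; i.e. the kernel $J_{\mathfrak{D}}$ of the semi-canonical presentation of its coordinate ring is a well-poised ideal.
   Context: $N$ is a lattice of finite rank, $M = \mathrm{Hom}(N,\mathbb{Z})$, $\sigma \subset N_{\mathbb{Q}}$ a pointed rational polyhedral cone with dual $\sigma^\vee$. A $\sigma$-polyhedron is a set $\Delta=\Pi+\sigma$ with $\Pi\subset N_{\mathbb{Q}}$ a rational polytope (the empty set is also allowed); for $u\in\sigma^\vee$, $\Delta(u)=\min_{v\in\Delta}\langle u,v\rangle$, with $\Delta(u)=\infty$ if $\Delta=\emptyset$. Affine arrangement variety: the affine variety $X = X(\mathfrak{D}) = \mathrm{Spec}\,R(\mathfrak{D})$ where $\mathfrak{D} = \sum_{i=0}^m \Delta_i\otimes V(\ell_i)$, the $\ell_i \in \mathbb{C}[x_0,\dots,x_c]$ are nonzero linear forms spanning $\mathbb{C}[x_0,\dots,x_c]_1$ (full rank hyperplane arrangement in $\mathbb{P}^c$), the $\Delta_i$ are $\sigma$-polyhedra with Minkowski sum $\sum_{i=0}^m \Delta_i \subsetneq \sigma$, and $R(\mathfrak{D}) = \bigoplus_{u\in\sigma^\vee\cap M} H^0\big(\mathbb{P}^c,\mathcal{O}(\sum_i\lfloor\Delta_i(u)\rfloor V(\ell_i))\big)\chi^u$ (coefficient $\infty$ means poles of arbitrary order; the hyperplanes need not be distinct). Semi-canonical embedding: embed $\mathbb{P}^c\to\mathbb{P}^m$ by $P\mapsto[\ell_0(P):\dots:\ell_m(P)]$;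 put $H_i=V(x_i)\subset\mathbb{P}^m$, $t_i = x_i/x_0$ the torus coordinates of $\mathbb{P}^m$, and $\mathfrak{D}_{\mathrm{toric}}=\sum_i\Delta_i\otimes H_i$, $R(\mathfrak{D}_{\mathrm{toric}})=\bigoplus_{u\in\sigma^\vee\cap M}H^0(\mathbb{P}^m,\mathcal{O}(\sum_i\lfloor\Delta_i(u)\rfloor H_i))\chi^u$. Let $e_1,\dots,e_m$ be the standard basis of $\mathbb{R}^m$, $e_0=-\sum_{i\ge1}e_i$, and $\delta\subseteq\mathbb{R}^m\times N_{\mathbb{R}}$ the positive hull of $(\{0\}\times\sigma)\cup\bigcup_{i=0}^m\{e_i\}\times\Delta_i$; $R(\mathfrak{D}_{\mathrm{toric}})$ has basis the $t^v\chi^u$ with $(v,u)\in\delta^\vee\cap(\mathbb{Z}^m\times M)$. Let $\mathcal{H}$ be a Hilbert basis of $\delta^\vee\cap(\mathbb{Z}^m\times M)$. A semi-canonical embedding is the one given by the surjection $\mathbb{C}[x_{(h,h')}:(h,h')\in\mathcal{H}]\to R(\mathfrak{D}_{\mathrm{toric}})\to R(\mathfrak{D})$, $x_{(h,h')}\mapsto t^h\chi^{h'}$ followed by restriction of sections to $\mathbb{P}^c$; its kernel is $J_{\mathfrak{D}}$. Well-poised: for $w$ real, $\mathrm{in}_w(f)$ is the sum of terms of $f$ of minimal $w$-weight, $\mathrm{in}_w(I)=\langle\mathrm{in}_w(f):f\in I\rangle$, and $\mathrm{Trop}(I)$ is the set of $w$ such that $\mathrm{in}_w(I)$ contains no monomial.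 A prime ideal $I$ of a polynomial ring over $\mathbb{C}$ containing no variable is well-poised if $\mathrm{in}_w(I)$ is prime for every $w\in\mathrm{Trop}(I)$. *)

theory Defs
  imports
    "HOL-Analysis.Analysis"
    "HOL-Analysis.Finite_Function_Topology"
    "HOL-Computational_Algebra.Fraction_Field"
    "HOL-Algebra.Ideal"
begin

section \<open>Polynomials in arbitrarily many variables, initial ideals, well-poised ideals\<close>

text \<open>
  The type below is the polynomial ring over the complex numbers with one variable for each
  element of the index type; the ring with a prescribed set \<open>V\<close> of variables is a subring
  of it, packaged as a record so that the notions of HOL-Algebra (ideals, generated ideals, prime
  ideals) can be applied to it.
\<close>

type_synonym 'v mpoly = "('v \<Rightarrow>\<^sub>0 nat) \<Rightarrow>\<^sub>0 complex"

definition mconst :: "complex \<Rightarrow> 'v mpoly" where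
  "mconst a = Poly_Mapping.single 0 a"

definition mvar :: "'v \<Rightarrow> 'v mpoly" where
  "mvar v = Poly_Mapping.single (Poly_Mapping.single v 1) 1"

definition mpoly_ring :: "'v set \<Rightarrow> 'v mpoly ring" where
  "mpoly_ring V =
     \<lparr>carrier = {p. \<forall>\<mu>\<in>Poly_Mapping.keys p. Poly_Mapping.keys \<mu> \<subseteq> V},
      monoid.mult = (*), one = 1, ring.zero = 0, add = (+)\<rparr>"

definition eval_mpoly :: "(complex \<Rightarrow> 'a::comm_ring_1) \<Rightarrow> ('v \<Rightarrow> 'a) \<Rightarrow> 'v mpoly \<Rightarrow> 'a" where
  "eval_mpoly \<kappa> \<phi> p =
     (\<Sum>\<mu>\<in>Poly_Mapping.keys p. \<kappa> (Poly_Mapping.lookup p \<mu>) *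
        (\<Prod>v\<in>Poly_Mapping.keys \<mu>. \<phi> v ^ Poly_Mapping.lookup \<mu> v))"

definition monomial_weight :: "('v \<Rightarrow> real) \<Rightarrow> ('v \<Rightarrow>\<^sub>0 nat) \<Rightarrow> real" where
  "monomial_weight w \<mu> =
     (\<Sum>v\<in>Poly_Mapping.keys \<mu>. real (Poly_Mapping.lookup \<mu> v) * w v)"

definition initial_form :: "('v \<Rightarrow> real) \<Rightarrow> 'v mpoly \<Rightarrow> 'v mpoly" where
  "initial_form w f =
     (\<Sum>\<mu> | \<mu> \<in> Poly_Mapping.keys f \<and>
            (\<forall>\<nu>\<in>Poly_Mapping.keys f. monomial_weight w \<mu> \<le> monomial_weight w \<nu>).
        Poly_Mapping.single \<mu> (Poly_Mapping.lookup f \<mu>))"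

definition initial_ideal :: "'v set \<Rightarrow> ('v \<Rightarrow> real) \<Rightarrow> 'v mpoly set \<Rightarrow> 'v mpoly set" where
  "initial_ideal V w I = Idl\<^bsub>mpoly_ring V\<^esub> (initial_form w ` I)"

text \<open>
  A weight is an arbitrary real function on the index type; only its values on \<open>V\<close> matter.
\<close>

definition Trop :: "'v set \<Rightarrow> 'v mpoly set \<Rightarrow> ('v \<Rightarrow> real) set" where
  "Trop V I = {w. \<forall>\<mu>. Poly_Mapping.keys \<mu> \<subseteq> V \<longrightarrow>
                    Poly_Mapping.single \<mu> 1 \<notin> initial_ideal V w I}"

definition well_poised :: "'v set \<Rightarrow> 'v mpoly set \<Rightarrow> bool" where
  "well_poised V I \<longleftrightarrow>
     primeideal I (mpoly_ring V) \<and> (\<forall>v\<in>V. mvar v \<notin> I) \<and>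
     (\<forall>w\<in>Trop V I. primeideal (initial_ideal V w I) (mpoly_ring V))"


section \<open>Lattices, cones and polyhedra\<close>

text \<open>
  The lattice \<open>N\<close> and its dual \<open>M\<close> are the integer vectors of type \<^typ>\<open>nat \<Rightarrow>\<^sub>0 int\<close> whose
  support is contained in \<open>{..<n}\<close> (rank 0 is allowed), and the real vector space spanned by
  \<open>N\<close> consists of the vectors of type \<^typ>\<open>nat \<Rightarrow>\<^sub>0 real\<close> with such support.
  Likewise the \<open>m\<close>-dimensional lattice and space containing \<open>e\<^sub>1,\<dots>,e\<^sub>m\<close> consist of the
  vectors supported in \<open>{1..m}\<close>.  Cones and polyhedra are real ones; rationality is a
  condition on their generators.
\<close>

type_synonym lattice_vec = "nat \<Rightarrow>\<^sub>0 int"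
type_synonym real_vec = "nat \<Rightarrow>\<^sub>0 real"

definition pairing :: "lattice_vec \<Rightarrow> real_vec \<Rightarrow> real" where
  "pairing u v =
     (\<Sum>j\<in>Poly_Mapping.keys u. of_int (Poly_Mapping.lookup u j) * Poly_Mapping.lookup v j)"

definition rational_points :: "nat \<Rightarrow> real_vec set" where
  "rational_points n =
     {v. Poly_Mapping.keys v \<subseteq> {..<n} \<and> (\<forall>j. Poly_Mapping.lookup v j \<in> \<rat>)}"

definition pointed_rational_cone :: "nat \<Rightarrow> real_vec set \<Rightarrow> bool" where
  "pointed_rational_cone n \<sigma> \<longleftrightarrow>
     (\<exists>G. finite G \<and> G \<subseteq> rational_points n \<and> \<sigma> = convex_cone hull G) \<and>
     \<sigma> \<inter> uminus ` \<sigma> = {0}"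

definition rational_polytope :: "nat \<Rightarrow> real_vec set \<Rightarrow> bool" where
  "rational_polytope n P \<longleftrightarrow>
     (\<exists>G. finite G \<and> G \<subseteq> rational_points n \<and> P = convex hull G)"

text \<open>The sum of sets is the Minkowski sum; \<open>P = {}\<close> gives the empty polyhedron.\<close>

definition sigma_polyhedron :: "nat \<Rightarrow> real_vec set \<Rightarrow> real_vec set \<Rightarrow> bool" where
  "sigma_polyhedron n \<sigma> \<Delta> \<longleftrightarrow> (\<exists>P. rational_polytope n P \<and> \<Delta> = P + \<sigma>)"

definition dual_cone_lattice :: "nat \<Rightarrow> real_vec set \<Rightarrow> lattice_vec set" where
  "dual_cone_lattice n \<sigma> =
     {u. Poly_Mapping.keys u \<subseteq> {..<n} \<and> (\<forall>v\<in>\<sigma>. 0 \<le> pairing u v)}"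

text \<open>
  For a \<open>\<sigma>\<close>-polyhedron and \<open>u\<close> in the dual of \<open>\<sigma>\<close> the infimum below is attained when the
  polyhedron is nonempty, and it is \<open>\<infinity>\<close> when the polyhedron is empty.
\<close>

definition support_value :: "real_vec set \<Rightarrow> lattice_vec \<Rightarrow> ereal" where
  "support_value \<Delta> u = (INF v\<in>\<Delta>. ereal (pairing u v))"

definition ereal_floor :: "ereal \<Rightarrow> ereal" where
  "ereal_floor x = (if \<bar>x\<bar> = \<infinity> then x else ereal (of_int \<lfloor>real_of_ereal x\<rfloor>))"

definition ray :: "nat \<Rightarrow> nat \<Rightarrow> real_vec" where
  "ray m i = (if i = 0 then - (\<Sum>j=1..m. Poly_Mapping.single j 1) else Poly_Mapping.single i 1)"

definition delta_cone ::
  "nat \<Rightarrow> real_vec set \<Rightarrow> (nat \<Rightarrow> real_vec set) \<Rightarrow> (real_vec \<times> real_vec) set" where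
  "delta_cone m \<sigma> \<Delta> = convex_cone hull ({0} \<times> \<sigma> \<union> (\<Union>i\<le>m. {ray m i} \<times> \<Delta> i))"

definition dual_delta_lattice ::
  "nat \<Rightarrow> nat \<Rightarrow> (real_vec \<times> real_vec) set \<Rightarrow> (lattice_vec \<times> lattice_vec) set" where
  "dual_delta_lattice m n \<delta> =
     {(h, u). Poly_Mapping.keys h \<subseteq> {1..m} \<and> Poly_Mapping.keys u \<subseteq> {..<n} \<and>
              (\<forall>(a, v)\<in>\<delta>. 0 \<le> pairing h a + pairing u v)}"

definition additive_submonoid :: "'a::monoid_add set \<Rightarrow> bool" where
  "additive_submonoid A \<longleftrightarrow> 0 \<in> A \<and> (\<forall>x\<in>A. \<forall>y\<in>A. x + y \<in> A)"

text \<open>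
  A Hilbert basis is a finite generating set of the monoid that is minimal under inclusion.
  It is unique if the monoid has no nontrivial units, but not in general.
\<close>

definition hilbert_basis :: "'a::monoid_add set \<Rightarrow> 'a set \<Rightarrow> bool" where
  "hilbert_basis H S \<longleftrightarrow>
     finite H \<and> additive_submonoid hull H = S \<and>
     (\<forall>H'. H' \<subset> H \<longrightarrow> additive_submonoid hull H' \<noteq> S)"


section \<open>Rational functions and sections on projective space\<close>

text \<open>
  The homogeneous coordinate ring of projective \<open>c\<close>-space uses the variables with indices
  \<open>0,\<dots>,c\<close>, so that its rational functions are fractions of homogeneous polynomials of equal
  degree in these variables.
\<close>

type_synonym ratfun = "nat mpoly fract"

definition hom_polys :: "nat \<Rightarrow> nat \<Rightarrow> nat mpoly set" where
  "hom_polys c d =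
     {p. \<forall>\<mu>\<in>Poly_Mapping.keys p. Poly_Mapping.keys \<mu> \<subseteq> {..c} \<and>
           (\<Sum>j\<in>Poly_Mapping.keys \<mu>. Poly_Mapping.lookup \<mu> j) = d}"

definition function_field :: "nat \<Rightarrow> ratfun set" where
  "function_field c = {Fract p q | p q d. p \<in> hom_polys c d \<and> q \<in> hom_polys c d \<and> q \<noteq> 0}"

text \<open>
  Linear forms \<open>L\<^sub>0,\<dots>,L\<^sub>m\<close>, all nonzero, that span the space of linear forms; they need not
  be pairwise non-proportional.
\<close>

definition full_rank_forms :: "nat \<Rightarrow> nat \<Rightarrow> (nat \<Rightarrow> nat mpoly) \<Rightarrow> bool" where
  "full_rank_forms c m L \<longleftrightarrow>
     (\<forall>i\<le>m. L i \<in> hom_polys c 1 \<and> L i \<noteq> 0) \<and>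
     {(\<Sum>i\<le>m. mconst (a i) * L i) | a. True} = hom_polys c 1"

definition poly_order :: "nat mpoly \<Rightarrow> nat mpoly \<Rightarrow> nat" where
  "poly_order \<pi> p = Max {k. \<pi> ^ k dvd p}"

definition ratfun_order :: "nat mpoly \<Rightarrow> ratfun \<Rightarrow> int" where
  "ratfun_order \<pi> f =
     (THE k. \<exists>p q. p \<noteq> 0 \<and> q \<noteq> 0 \<and> f = Fract p q \<and>
                   k = int (poly_order \<pi> p) - int (poly_order \<pi> q))"

text \<open>
  Global sections of the divisor \<open>\<Sum>\<^sub>i a\<^sub>i V(L\<^sub>i)\<close>.  The prime divisors of projective space are
  the \<open>V(\<pi>)\<close> with \<open>\<pi>\<close> irreducible and homogeneous, and \<open>V(L\<^sub>i) = V(\<pi>)\<close> iff \<open>\<pi>\<close> divides the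
  linear form \<open>L\<^sub>i\<close>; the sum over all such \<open>i\<close> is the coefficient of \<open>V(\<pi>)\<close> in the divisor,
  and the value \<open>\<infinity>\<close> allows poles of arbitrary order.
\<close>

definition global_sections ::
  "nat \<Rightarrow> nat \<Rightarrow> (nat \<Rightarrow> nat mpoly) \<Rightarrow> (nat \<Rightarrow> ereal) \<Rightarrow> ratfun set" where
  "global_sections c m L a =
     {f \<in> function_field c. f \<noteq> 0 \<longrightarrow>
        (\<forall>\<pi> d. \<pi> \<in> hom_polys c d \<longrightarrow> irreducible \<pi> \<longrightarrow>
           0 \<le> ereal (of_int (ratfun_order \<pi> f)) + (\<Sum>i | i \<le> m \<and> \<pi> dvd L i. a i))}"

text \<open>
  \<open>R(\<DD>)\<close> for \<open>\<DD> = \<Sum>\<^sub>i \<Delta>\<^sub>i \<otimes> V(L\<^sub>i)\<close>, as a subring of the group algebra of \<open>M\<close>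
  over the function field: the coefficient of \<open>\<chi>\<^sup>u\<close> in \<open>g\<close> is \<open>Poly_Mapping.lookup g u\<close>.
\<close>

definition section_ring ::
  "nat \<Rightarrow> real_vec set \<Rightarrow> nat \<Rightarrow> nat \<Rightarrow> (nat \<Rightarrow> nat mpoly) \<Rightarrow> (nat \<Rightarrow> real_vec set) \<Rightarrow>
   (lattice_vec \<Rightarrow>\<^sub>0 ratfun) ring" where
  "section_ring n \<sigma> c m L \<Delta> =
     \<lparr>carrier = {g. \<forall>u\<in>Poly_Mapping.keys g. u \<in> dual_cone_lattice n \<sigma> \<and>
         Poly_Mapping.lookup g u
           \<in> global_sections c m L (\<lambda>i. ereal_floor (support_value (\<Delta> i) u))},
      monoid.mult = (*), one = 1, ring.zero = 0, add = (+)\<rparr>"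

text \<open>
  With \<open>t\<^sub>i = x\<^sub>i / x\<^sub>0\<close> this sends the variable with index \<open>(h, h')\<close> to \<open>t\<^sup>h \<chi>\<^bsup>h'\<^esup>\<close>.  For a set
  of variables contained in \<^const>\<open>dual_delta_lattice\<close> the values lie in \<open>R(\<DD>\<^sub>t\<^sub>o\<^sub>r\<^sub>i\<^sub>c)\<close>, which is
  the ring \<open>section_ring n \<sigma> m m mvar \<Delta>\<close>.
\<close>

definition toric_presentation ::
  "nat \<Rightarrow> (lattice_vec \<times> lattice_vec) mpoly \<Rightarrow> (lattice_vec \<Rightarrow>\<^sub>0 ratfun)" where
  "toric_presentation m =
     eval_mpoly (\<lambda>a. Poly_Mapping.single 0 (Fract (mconst a) 1))
       (\<lambda>(h, h'). Poly_Mapping.single h'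
          (\<Prod>i=1..m. Fract (mvar i) (mvar 0) powi Poly_Mapping.lookup h i))"

text \<open>
  Restriction of rational functions along the embedding \<open>P \<mapsto> [L\<^sub>0(P) : \<dots> : L\<^sub>m(P)]\<close>, meaningful
  for functions with a denominator that does not vanish identically on the image.
\<close>

definition restrict_ratfun :: "(nat \<Rightarrow> nat mpoly) \<Rightarrow> ratfun \<Rightarrow> ratfun" where
  "restrict_ratfun L f =
     (THE g. \<exists>p q. q \<noteq> 0 \<and> eval_mpoly mconst L q \<noteq> 0 \<and> f = Fract p q \<and>
                   g = Fract (eval_mpoly mconst L p) (eval_mpoly mconst L q))"

definition restrict_sections ::
  "(nat \<Rightarrow> nat mpoly) \<Rightarrow> (lattice_vec \<Rightarrow>\<^sub>0 ratfun) \<Rightarrow> (lattice_vec \<Rightarrow>\<^sub>0 ratfun)" where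
  "restrict_sections L = Poly_Mapping.map (restrict_ratfun L)"

definition semi_canonical_ideal ::
  "nat \<Rightarrow> real_vec set \<Rightarrow> nat \<Rightarrow> nat \<Rightarrow> (nat \<Rightarrow> nat mpoly) \<Rightarrow> (nat \<Rightarrow> real_vec set) \<Rightarrow>
   (lattice_vec \<times> lattice_vec) set \<Rightarrow> (lattice_vec \<times> lattice_vec) mpoly set" where
  "semi_canonical_ideal n \<sigma> c m L \<Delta> H =
     a_kernel (mpoly_ring H) (section_ring n \<sigma> c m L \<Delta>)
       (restrict_sections L \<circ> toric_presentation m)"

end

theory Submission
  imports Defs
begin

text \<open>
  Write \<open>S\<close> for the monoid of the pairs \<open>(h, u)\<close> with \<open>t\<^sup>h \<chi>\<^sup>u\<close> in the toric section ring.  The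
  semi-canonical presentation sends the variable with index \<open>(h, u)\<close> to the product of the
  quotients \<open>L\<^sub>i / L\<^sub>0\<close>, raised to the powers \<open>h\<^sub>i\<close>, and of \<open>\<chi>\<^sup>u\<close>.  So its kernel is the kernel of a homomorphism to
  the group algebra of a free abelian group over a field, which is a domain, and the kernel is prime
  for every system of nonzero forms \<open>L\<close> (\<open>primeideal_arrangement_ideal\<close>).  The theorem holds
  because the initial ideal at a tropical weight is again a kernel of this kind, for another system
  \<open>L'\<close> of nonzero linear forms.  Three observations produce \<open>L'\<close>.

  First, two monomials of the same degree in \<open>S\<close> differ by an element of the kernel, so a tropical
  weight depends on degrees only, and it is additive.  Additivity forces it to be affine on each
  slice of \<open>S\<close> with fixed \<open>u\<close>, with a slope that is the same for all slices and is given by weights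
  \<open>a\<^sub>0, \<dots>, a\<^sub>m\<close> for the forms \<open>L\<^sub>0, \<dots>, L\<^sub>m\<close> (\<open>adapted_if_degree_weight\<close>).

  Secondly, a system of linear forms degenerates along any weights \<open>a\<close>
  (\<open>exists_linear_degeneration\<close>).  Choose a basis of the span of the forms greedily in
  the order of decreasing weight; then each \<open>L\<^sub>i\<close> is a combination of basis forms of weight at least
  \<open>a\<^sub>i\<close>, and \<open>L'\<^sub>i\<close> is the part that involves the basis forms of weight exactly \<open>a\<^sub>i\<close>.  Basis forms
  are algebraically independent, so they serve as variables.  Initial forms of relations among the
  \<open>L\<^sub>i\<close> are relations among the \<open>L'\<^sub>i\<close>.  Conversely, let \<open>F\<close> be a form of degree \<open>d\<close>, homogeneous for
  the weight, with \<open>F(L') = 0\<close>.  Expanded in the basis forms, \<open>F(L)\<close> has only terms of higher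
  weight.  But basis forms are among the \<open>L\<^sub>i\<close>, so the expansion itself is \<open>P(L)\<close> for a form
  \<open>P\<close> of degree \<open>d\<close> all of whose terms have higher weight, and \<open>F\<close> is the initial form of the
  relation \<open>F - P\<close>.

  Thirdly, each slice of \<open>S\<close> is cut out by lower bounds on the homogeneous exponents
  (\<open>in_dual_delta_lattice_iff\<close>).  Hence all monomials of degree \<open>d\<close>, shifted by the same
  lower bounds, occur in the slice together, and \<open>F - P\<close> lifts to an element of the kernel whose
  initial form is a prescribed lift of \<open>F\<close> (\<open>in_initial_ideal_if_relation\<close>).  This shows that
  the initial ideal contains the kernel for \<open>L'\<close>; the other inclusion is the statement on initial
  forms of relations.  The forms \<open>L'\<^sub>i\<close> do not vanish: a relation \<open>L'\<^sub>i = 0\<close> would lift in the same way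
  to an element of the kernel whose initial form is a monomial (\<open>degenerate_form_nonzero\<close>).
\<close>

section \<open>Evaluation of polynomials\<close>

definition monomial_value :: "('v \<Rightarrow> 'a::comm_ring_1) \<Rightarrow> ('v \<Rightarrow>\<^sub>0 nat) \<Rightarrow> 'a" where
  "monomial_value \<phi> \<mu> = (\<Prod>v\<in>Poly_Mapping.keys \<mu>. \<phi> v ^ Poly_Mapping.lookup \<mu> v)"

lemma monomial_value_superset:
  assumes "finite A" "Poly_Mapping.keys \<mu> \<subseteq> A"
  shows "monomial_value \<phi> \<mu> = (\<Prod>v\<in>A. \<phi> v ^ Poly_Mapping.lookup \<mu> v)"
  unfolding monomial_value_def
  by (rule prod.mono_neutral_left) (use assms in \<open>auto simp: in_keys_iff\<close>)

lemma monomial_value_add: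
  "monomial_value \<phi> (\<mu> + \<nu>) = monomial_value \<phi> \<mu> * monomial_value \<phi> \<nu>"
proof -
  let ?A = "Poly_Mapping.keys \<mu> \<union> Poly_Mapping.keys \<nu>"
  have "Poly_Mapping.keys (\<mu> + \<nu>) \<subseteq> ?A" by (rule keys_add)
  then show ?thesis
    by (simp add: monomial_value_superset[of ?A] lookup_add power_add prod.distrib)
qed

lemma monomial_value_zero [simp]: "monomial_value \<phi> 0 = 1"
  by (simp add: monomial_value_def)

lemma monomial_value_single [simp]: "monomial_value \<phi> (Poly_Mapping.single v 1) = \<phi> v"
  by (simp add: monomial_value_def)

lemma poly_mapping_sum_singles:
  "p = (\<Sum>\<mu>\<in>Poly_Mapping.keys p. Poly_Mapping.single \<mu> (Poly_Mapping.lookup p \<mu>))"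
  by (rule poly_mapping_eqI)
     (auto simp: lookup_sum lookup_single when_def in_keys_iff)

text \<open>
  Both the substitution of forms into polynomials and the presentation of a section ring are
  evaluations; they differ in the ring that receives the scalars.
\<close>

locale coefficient_hom =
  fixes \<kappa> :: "complex \<Rightarrow> 'a::comm_ring_1"
  assumes hom_zero: "\<kappa> 0 = 0" and hom_one: "\<kappa> 1 = 1"
    and hom_add: "\<kappa> (a + b) = \<kappa> a + \<kappa> b" and hom_mult: "\<kappa> (a * b) = \<kappa> a * \<kappa> b"
begin

lemma eval_superset:
  assumes "finite A" "Poly_Mapping.keys p \<subseteq> A"
  shows "eval_mpoly \<kappa> \<phi> p = (\<Sum>\<mu>\<in>A. \<kappa> (Poly_Mapping.lookup p \<mu>) * monomial_value \<phi> \<mu>)"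
  unfolding eval_mpoly_def monomial_value_def[symmetric]
  by (rule sum.mono_neutral_left) (use assms in \<open>auto simp: in_keys_iff hom_zero\<close>)

lemma eval_add: "eval_mpoly \<kappa> \<phi> (p + q) = eval_mpoly \<kappa> \<phi> p + eval_mpoly \<kappa> \<phi> q"
proof -
  let ?A = "Poly_Mapping.keys p \<union> Poly_Mapping.keys q"
  have "Poly_Mapping.keys (p + q) \<subseteq> ?A" by (rule keys_add)
  then show ?thesis
    by (simp add: eval_superset[of ?A] lookup_add hom_add distrib_right sum.distrib)
qed

lemma eval_zero [simp]: "eval_mpoly \<kappa> \<phi> 0 = 0"
  by (simp add: eval_mpoly_def)

lemma eval_sum: "eval_mpoly \<kappa> \<phi> (sum f A) = (\<Sum>x\<in>A. eval_mpoly \<kappa> \<phi> (f x))"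
  by (induction A rule: infinite_finite_induct) (auto simp: eval_add)

lemma eval_single: "eval_mpoly \<kappa> \<phi> (Poly_Mapping.single \<mu> c) = \<kappa> c * monomial_value \<phi> \<mu>"
  by (subst eval_superset[of "{\<mu>}"]) auto

lemma eval_one [simp]: "eval_mpoly \<kappa> \<phi> 1 = 1"
  by (simp add: eval_single hom_one flip: single_one)

lemma eval_mconst [simp]: "eval_mpoly \<kappa> \<phi> (mconst c) = \<kappa> c"
  by (simp add: mconst_def eval_single)

lemma eval_mvar [simp]: "eval_mpoly \<kappa> \<phi> (mvar v) = \<phi> v"
  by (simp add: mvar_def eval_single hom_one del: monomial_value_single)
     (simp add: monomial_value_def)

lemma eval_mult: "eval_mpoly \<kappa> \<phi> (p * q) = eval_mpoly \<kappa> \<phi> p * eval_mpoly \<kappa> \<phi> q"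
proof -
  let ?s = "\<lambda>p \<mu>. Poly_Mapping.single \<mu> (Poly_Mapping.lookup p \<mu>)"
  have expand: "eval_mpoly \<kappa> \<phi> p = (\<Sum>\<mu>\<in>Poly_Mapping.keys p. eval_mpoly \<kappa> \<phi> (?s p \<mu>))" for p :: "'b mpoly"
    by (subst poly_mapping_sum_singles[of p]) (rule eval_sum)
  have "p * q = (\<Sum>\<mu>\<in>Poly_Mapping.keys p. \<Sum>\<nu>\<in>Poly_Mapping.keys q. ?s p \<mu> * ?s q \<nu>)"
    by (subst poly_mapping_sum_singles[of p], subst poly_mapping_sum_singles[of q])
       (rule sum_product)
  then have "eval_mpoly \<kappa> \<phi> (p * q) =
      (\<Sum>\<mu>\<in>Poly_Mapping.keys p. \<Sum>\<nu>\<in>Poly_Mapping.keys q. eval_mpoly \<kappa> \<phi> (?s p \<mu> * ?s q \<nu>))"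
    by (simp only: eval_sum)
  also have "\<dots> = (\<Sum>\<mu>\<in>Poly_Mapping.keys p. \<Sum>\<nu>\<in>Poly_Mapping.keys q.
                     eval_mpoly \<kappa> \<phi> (?s p \<mu>) * eval_mpoly \<kappa> \<phi> (?s q \<nu>))"
    by (simp add: mult_single eval_single hom_mult monomial_value_add mult_ac)
  finally show ?thesis
    by (simp add: sum_product expand[of p] expand[of q])
qed

lemma eval_minus: "eval_mpoly \<kappa> \<phi> (- p) = - eval_mpoly \<kappa> \<phi> p"
  using eval_add[of \<phi> p "- p"] by (simp add: eq_neg_iff_add_eq_0 add.commute)

lemma eval_power: "eval_mpoly \<kappa> \<phi> (p ^ k) = eval_mpoly \<kappa> \<phi> p ^ k"
  by (induction k) (auto simp: eval_mult)

lemma eval_prod: "eval_mpoly \<kappa> \<phi> (prod f A) = (\<Prod>x\<in>A. eval_mpoly \<kappa> \<phi> (f x))"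
  by (induction A rule: infinite_finite_induct) (auto simp: eval_mult)

end

lemma mconst_simps:
  "mconst 0 = 0" "mconst 1 = 1" "mconst (a + b) = mconst a + mconst b"
  "mconst (a * b) = mconst a * mconst b" "mconst (- a) = - mconst a"
  by (auto simp: mconst_def single_add mult_single single_uminus)

interpretation poly: coefficient_hom mconst
  by standard (simp_all add: mconst_simps)

lemma sum_mconst_single:
  "p = (\<Sum>\<mu>\<in>Poly_Mapping.keys p. mconst (Poly_Mapping.lookup p \<mu>) * Poly_Mapping.single \<mu> 1)"
  by (subst poly_mapping_sum_singles[of p]) (simp add: mconst_def mult_single)

section \<open>The ring record of polynomials in given variables\<close>

lemma mpoly_ring_simps:
  "carrier (mpoly_ring V) = {p. \<forall>\<mu>\<in>Poly_Mapping.keys p. Poly_Mapping.keys \<mu> \<subseteq> V}"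
  "\<one>\<^bsub>mpoly_ring V\<^esub> = 1" "\<zero>\<^bsub>mpoly_ring V\<^esub> = 0"
  "x \<otimes>\<^bsub>mpoly_ring V\<^esub> y = x * y" "x \<oplus>\<^bsub>mpoly_ring V\<^esub> y = x + y"
  by (simp_all add: mpoly_ring_def)

lemma carrier_add:
  "p \<in> carrier (mpoly_ring V) \<Longrightarrow> q \<in> carrier (mpoly_ring V) \<Longrightarrow> p + q \<in> carrier (mpoly_ring V)"
  using keys_add[of p q] by (auto simp: mpoly_ring_simps)

lemma carrier_mult:
  assumes "p \<in> carrier (mpoly_ring V)" "q \<in> carrier (mpoly_ring V)"
  shows "p * q \<in> carrier (mpoly_ring V)"
proof -
  have "Poly_Mapping.keys \<mu> \<subseteq> V" if \<mu>: "\<mu> \<in> Poly_Mapping.keys (p * q)" for \<mu>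
  proof -
    obtain a b where "\<mu> = a + b" "a \<in> Poly_Mapping.keys p" "b \<in> Poly_Mapping.keys q"
      using subsetD[OF keys_mult \<mu>] by blast
    then show ?thesis using assms keys_add[of a b] by (simp add: mpoly_ring_simps) blast
  qed
  then show ?thesis by (simp add: mpoly_ring_simps)
qed

lemma carrier_minus: "p \<in> carrier (mpoly_ring V) \<Longrightarrow> - p \<in> carrier (mpoly_ring V)"
  by (simp add: mpoly_ring_simps in_keys_iff)

lemma carrier_sum:
  "(\<And>x. x \<in> A \<Longrightarrow> f x \<in> carrier (mpoly_ring V)) \<Longrightarrow> sum f A \<in> carrier (mpoly_ring V)"
proof (induction A rule: infinite_finite_induct)
  case (insert x F)
  then show ?case by (simp add: carrier_add)
qed (simp_all add: mpoly_ring_simps)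

lemma carrier_single:
  "Poly_Mapping.keys \<mu> \<subseteq> V \<Longrightarrow> Poly_Mapping.single \<mu> c \<in> carrier (mpoly_ring V)"
  by (auto simp: mpoly_ring_simps split: if_splits)

lemma cring_mpoly_ring: "cring (mpoly_ring V)"
proof (rule cringI)
  show "abelian_group (mpoly_ring V)"
  proof (rule abelian_groupI)
    fix x assume "x \<in> carrier (mpoly_ring V)"
    then show "\<exists>y\<in>carrier (mpoly_ring V). y \<oplus>\<^bsub>mpoly_ring V\<^esub> x = \<zero>\<^bsub>mpoly_ring V\<^esub>"
      by (intro bexI[of _ "- x"]) (auto simp: carrier_minus mpoly_ring_simps(3,5))
  qed (auto simp: carrier_add mpoly_ring_simps(3,5) add_ac, simp add: mpoly_ring_simps)
  show "comm_monoid (mpoly_ring V)"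
    by (rule comm_monoidI)
       (auto simp: carrier_mult mpoly_ring_simps(2,4) mult_ac, simp add: mpoly_ring_simps)
qed (simp add: mpoly_ring_simps distrib_right)

lemma mpoly_ring_idealI:
  assumes "I \<subseteq> carrier (mpoly_ring V)" "0 \<in> I" "\<And>p q. p \<in> I \<Longrightarrow> q \<in> I \<Longrightarrow> p + q \<in> I"
    and "\<And>p q. p \<in> carrier (mpoly_ring V) \<Longrightarrow> q \<in> I \<Longrightarrow> p * q \<in> I"
  shows "ideal I (mpoly_ring V)"
proof -
  interpret cring "mpoly_ring V" by (rule cring_mpoly_ring)
  have minus_one: "(- 1 :: 'a mpoly) \<in> carrier (mpoly_ring V)"
    by (rule carrier_minus) (simp add: mpoly_ring_simps)
  have inverse: "\<ominus>\<^bsub>mpoly_ring V\<^esub> p = - p" if "p \<in> carrier (mpoly_ring V)" for p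
    using that carrier_minus[OF that]
    by (intro minus_equality) (auto simp: mpoly_ring_simps(3,5))
  show ?thesis
  proof (rule idealI)
    show "subgroup I (add_monoid (mpoly_ring V))"
    proof (rule add.subgroupI)
      fix p assume "p \<in> I"
      moreover have "- p \<in> I"
        using assms(4)[OF minus_one \<open>p \<in> I\<close>] by simp
      ultimately show "\<ominus>\<^bsub>mpoly_ring V\<^esub> p \<in> I"
        using assms(1) inverse by auto
    qed (use assms(1-3) in \<open>auto simp: mpoly_ring_simps(5)\<close>)
    show "p \<otimes>\<^bsub>mpoly_ring V\<^esub> q \<in> I" if "p \<in> I" "q \<in> carrier (mpoly_ring V)" for p q
      using assms(4)[OF that(2,1)] by (simp add: mpoly_ring_simps(4) mult.commute)
  qed (use assms(4) in \<open>auto simp: mpoly_ring_simps(4) ring_axioms\<close>)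
qed

lemma ideal_closed:
  assumes "ideal I (mpoly_ring V)"
  shows "0 \<in> I" "p \<in> I \<Longrightarrow> q \<in> I \<Longrightarrow> p + q \<in> I"
proof -
  interpret ideal I "mpoly_ring V" by fact
  show "0 \<in> I" "p \<in> I \<Longrightarrow> q \<in> I \<Longrightarrow> p + q \<in> I"
    using additive_subgroup.zero_closed[OF additive_subgroup_axioms]
      additive_subgroup.a_closed[OF additive_subgroup_axioms, of p q]
    by (auto simp: mpoly_ring_simps(3,5))
qed

lemma ideal_sum_closed:
  assumes "ideal I (mpoly_ring V)" "\<And>x. x \<in> A \<Longrightarrow> f x \<in> I"
  shows "sum f A \<in> I"
  using assms(2) by (induction A rule: infinite_finite_induct) (auto simp: ideal_closed[OF assms(1)])

section \<open>Degrees and weights of monomials\<close>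

text \<open>
  The degree for the grading in which every variable is its own degree.  Multiples are iterated sums,
  since the index type is only a monoid.
\<close>

definition monomial_degree :: "('a::comm_monoid_add \<Rightarrow>\<^sub>0 nat) \<Rightarrow> 'a" where
  "monomial_degree \<mu> = (\<Sum>v\<in>Poly_Mapping.keys \<mu>. \<Sum>k<Poly_Mapping.lookup \<mu> v. v)"

lemma monomial_degree_superset:
  assumes "finite A" "Poly_Mapping.keys \<mu> \<subseteq> A"
  shows "monomial_degree \<mu> = (\<Sum>v\<in>A. \<Sum>k<Poly_Mapping.lookup \<mu> v. v)"
  unfolding monomial_degree_def
  by (rule sum.mono_neutral_left) (use assms in \<open>auto simp: in_keys_iff\<close>)

lemma sum_lessThan_add:
  fixes v :: "'a::comm_monoid_add"
  shows "(\<Sum>k<(i + j :: nat). v) = (\<Sum>k<i. v) + (\<Sum>k<j. v)"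
  by (induction j) (auto simp: add_ac)

lemma sum_sum_lessThan_const:
  fixes v :: "'b::comm_monoid_add"
  assumes "finite A"
  shows "(\<Sum>i\<in>A. \<Sum>k<(\<alpha> i :: nat). v) = (\<Sum>k<sum \<alpha> A. v)"
  using assms by (induction A rule: finite_induct) (auto simp: sum_lessThan_add)

lemma monomial_degree_add:
  "monomial_degree (\<mu> + \<nu>) = monomial_degree \<mu> + monomial_degree \<nu>"
proof -
  let ?A = "Poly_Mapping.keys \<mu> \<union> Poly_Mapping.keys \<nu>"
  have "Poly_Mapping.keys (\<mu> + \<nu>) \<subseteq> ?A" by (rule keys_add)
  then show ?thesis
    by (simp add: monomial_degree_superset[of ?A] lookup_add sum_lessThan_add sum.distrib)
qed

lemma monomial_degree_zero [simp]: "monomial_degree 0 = 0"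
  by (simp add: monomial_degree_def)

lemma monomial_degree_single [simp]: "monomial_degree (Poly_Mapping.single v (Suc 0)) = v"
  by (simp add: monomial_degree_def)

type_synonym graded_monomial = "lattice_vec \<times> lattice_vec \<Rightarrow>\<^sub>0 nat"

abbreviation torus_degree :: "graded_monomial \<Rightarrow> lattice_vec" where
  "torus_degree \<mu> \<equiv> fst (monomial_degree \<mu>)"

abbreviation character_degree :: "graded_monomial \<Rightarrow> lattice_vec" where
  "character_degree \<mu> \<equiv> snd (monomial_degree \<mu>)"

lemma monomial_weight_superset:
  assumes "finite A" "Poly_Mapping.keys \<mu> \<subseteq> A"
  shows "monomial_weight w \<mu> = (\<Sum>v\<in>A. real (Poly_Mapping.lookup \<mu> v) * w v)"
  unfolding monomial_weight_def
  by (rule sum.mono_neutral_left) (use assms in \<open>auto simp: in_keys_iff\<close>)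

lemma monomial_weight_add:
  "monomial_weight w (\<mu> + \<nu>) = monomial_weight w \<mu> + monomial_weight w \<nu>"
proof -
  let ?A = "Poly_Mapping.keys \<mu> \<union> Poly_Mapping.keys \<nu>"
  have "Poly_Mapping.keys (\<mu> + \<nu>) \<subseteq> ?A" by (rule keys_add)
  then show ?thesis
    by (simp add: monomial_weight_superset[of ?A] lookup_add distrib_right sum.distrib)
qed

lemma monomial_weight_zero [simp]: "monomial_weight w 0 = 0"
  by (simp add: monomial_weight_def)

lemma monomial_weight_sum:
  "monomial_weight w (sum f A) = (\<Sum>x\<in>A. monomial_weight w (f x))"
  by (induction A rule: infinite_finite_induct) (auto simp: monomial_weight_add)

lemma monomial_degree_sum:
  "monomial_degree (sum f A) = (\<Sum>x\<in>A. monomial_degree (f x))"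
  by (induction A rule: infinite_finite_induct) (auto simp: monomial_degree_add)

text \<open>
  This is why a presentation by characters of a monoid sees only the degrees of monomials.
\<close>

lemma monomial_value_character:
  fixes \<theta> :: "'v::comm_monoid_add \<Rightarrow> 'a::comm_ring_1"
  assumes "\<theta> 0 = 1" "\<And>x y. \<theta> (x + y) = \<theta> x * \<theta> y"
  shows "monomial_value \<theta> \<mu> = \<theta> (monomial_degree \<mu>)"
proof -
  have power: "\<theta> (\<Sum>k<(n::nat). v) = \<theta> v ^ n" for n v
    by (induction n) (auto simp: assms mult.commute)
  have "\<theta> (sum f A) = (\<Prod>x\<in>A. \<theta> (f x))" for f and A :: "'v set"
    by (induction A rule: infinite_finite_induct) (auto simp: assms)
  then show ?thesis
    by (simp only: monomial_value_def monomial_degree_def power)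
qed

text \<open>
  The form in which generation of the monoid by a Hilbert basis is used: every element of the monoid
  lifts to a monomial.
\<close>

lemma hull_eq_monomial_degrees:
  fixes H :: "'v::comm_monoid_add set"
  shows "additive_submonoid hull H = monomial_degree ` {\<mu>. Poly_Mapping.keys \<mu> \<subseteq> H}"
proof
  show "additive_submonoid hull H \<subseteq> monomial_degree ` {\<mu>. Poly_Mapping.keys \<mu> \<subseteq> H}"
  proof (rule hull_minimal)
    show "H \<subseteq> monomial_degree ` {\<mu>. Poly_Mapping.keys \<mu> \<subseteq> H}"
    proof
      fix v assume "v \<in> H"
      then show "v \<in> monomial_degree ` {\<mu>. Poly_Mapping.keys \<mu> \<subseteq> H}"
        by (intro image_eqI[of _ _ "Poly_Mapping.single v 1"]) auto
    qed
    have "monomial_degree \<mu> + monomial_degree \<nu> \<in> monomial_degree ` {\<mu>. Poly_Mapping.keys \<mu> \<subseteq> H}"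
      if "Poly_Mapping.keys \<mu> \<subseteq> H" "Poly_Mapping.keys \<nu> \<subseteq> H" for \<mu> \<nu>
      using that keys_add[of \<mu> \<nu>]
      by (intro image_eqI[of _ _ "\<mu> + \<nu>"]) (auto simp: monomial_degree_add)
    moreover have "0 \<in> monomial_degree ` {\<mu>. Poly_Mapping.keys \<mu> \<subseteq> H}"
      by (rule image_eqI[of _ _ 0]) auto
    ultimately show "additive_submonoid (monomial_degree ` {\<mu>. Poly_Mapping.keys \<mu> \<subseteq> H})"
      by (auto simp: additive_submonoid_def)
  qed
  have "additive_submonoid (additive_submonoid hull H)"
    by (rule hull_in) (auto simp: additive_submonoid_def)
  then have closed: "sum f A \<in> additive_submonoid hull H"
    if "\<And>x. x \<in> A \<Longrightarrow> f x \<in> additive_submonoid hull H" for f and A :: "'v set"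
    using that
    by (induction A rule: infinite_finite_induct) (auto simp: additive_submonoid_def)
  have closed': "(\<Sum>k<(j::nat). v) \<in> additive_submonoid hull H" if "v \<in> H" for j v
  proof -
    have "v \<in> additive_submonoid hull H" using that by (rule hull_inc)
    then show ?thesis
      using \<open>additive_submonoid (additive_submonoid hull H)\<close>
      by (induction j) (auto simp: additive_submonoid_def)
  qed
  show "monomial_degree ` {\<mu>. Poly_Mapping.keys \<mu> \<subseteq> H} \<subseteq> additive_submonoid hull H"
    by (auto simp del: sum_constant simp: monomial_degree_def in_mono intro!: closed closed')
qed

section \<open>Initial degenerations of a system of linear forms\<close>

definition exponent_weight :: "nat \<Rightarrow> (nat \<Rightarrow> real) \<Rightarrow> (nat \<Rightarrow> nat) \<Rightarrow> real" where
  "exponent_weight m a \<alpha> = (\<Sum>i\<le>m. real (\<alpha> i) * a i)"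

definition power_product :: "nat \<Rightarrow> (nat \<Rightarrow> 'a::comm_ring_1) \<Rightarrow> (nat \<Rightarrow> nat) \<Rightarrow> 'a" where
  "power_product m L \<alpha> = (\<Prod>i\<le>m. L i ^ \<alpha> i)"

definition total_degree :: "('v \<Rightarrow>\<^sub>0 nat) \<Rightarrow> nat" where
  "total_degree \<mu> = (\<Sum>j\<in>Poly_Mapping.keys \<mu>. Poly_Mapping.lookup \<mu> j)"

lemma total_degree_superset:
  assumes "finite A" "Poly_Mapping.keys \<mu> \<subseteq> A"
  shows "total_degree \<mu> = (\<Sum>j\<in>A. Poly_Mapping.lookup \<mu> j)"
  unfolding total_degree_def
  by (rule sum.mono_neutral_left) (use assms in \<open>auto simp: in_keys_iff\<close>)

lemma total_degree_add: "total_degree (\<mu> + \<nu>) = total_degree \<mu> + total_degree \<nu>"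
proof -
  let ?A = "Poly_Mapping.keys \<mu> \<union> Poly_Mapping.keys \<nu>"
  have "Poly_Mapping.keys (\<mu> + \<nu>) \<subseteq> ?A" by (rule keys_add)
  then show ?thesis
    by (simp add: total_degree_superset[of ?A] lookup_add sum.distrib)
qed

lemma hom_polys_iff:
  "p \<in> hom_polys c d \<longleftrightarrow>
    (\<forall>\<mu>\<in>Poly_Mapping.keys p. Poly_Mapping.keys \<mu> \<subseteq> {..c} \<and> total_degree \<mu> = d)"
  by (simp add: hom_polys_def total_degree_def)

lemma hom_polys_zero: "0 \<in> hom_polys c d"
  by (simp add: hom_polys_def)

lemma hom_polys_add: "p \<in> hom_polys c d \<Longrightarrow> q \<in> hom_polys c d \<Longrightarrow> p + q \<in> hom_polys c d"
  using keys_add[of p q] by (auto simp: hom_polys_def)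

lemma hom_polys_sum: "(\<And>x. x \<in> A \<Longrightarrow> f x \<in> hom_polys c d) \<Longrightarrow> sum f A \<in> hom_polys c d"
  by (induction A rule: infinite_finite_induct) (auto simp: hom_polys_zero hom_polys_add)

lemma hom_polys_mult:
  assumes "p \<in> hom_polys c d" "q \<in> hom_polys c e"
  shows "p * q \<in> hom_polys c (d + e)"
  unfolding hom_polys_iff
proof
  fix \<mu> assume \<mu>: "\<mu> \<in> Poly_Mapping.keys (p * q)"
  obtain a b where "\<mu> = a + b" "a \<in> Poly_Mapping.keys p" "b \<in> Poly_Mapping.keys q"
    using subsetD[OF keys_mult \<mu>] by blast
  then show "Poly_Mapping.keys \<mu> \<subseteq> {..c} \<and> total_degree \<mu> = d + e"
    using assms keys_add[of a b] by (simp add: hom_polys_iff total_degree_add) blast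
qed

lemma hom_polys_one: "1 \<in> hom_polys c 0"
  by (simp add: hom_polys_def)

lemma hom_polys_mconst: "mconst a \<in> hom_polys c 0"
  by (simp add: hom_polys_def mconst_def)

lemma hom_polys_scale: "p \<in> hom_polys c d \<Longrightarrow> mconst a * p \<in> hom_polys c d"
  using hom_polys_mult[OF hom_polys_mconst] by simp

lemma hom_polys_minus: "p \<in> hom_polys c d \<Longrightarrow> - p \<in> hom_polys c d"
  by (simp add: hom_polys_def in_keys_iff)

lemma hom_polys_mvar: "i \<le> c \<Longrightarrow> mvar i \<in> hom_polys c 1"
  by (simp add: hom_polys_def mvar_def)

lemma hom_polys_power: "p \<in> hom_polys c d \<Longrightarrow> p ^ k \<in> hom_polys c (k * d)"
  by (induction k) (auto simp: hom_polys_one hom_polys_mult)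

lemma hom_polys_prod:
  "finite A \<Longrightarrow> (\<And>x. x \<in> A \<Longrightarrow> f x \<in> hom_polys c (d x)) \<Longrightarrow> prod f A \<in> hom_polys c (sum d A)"
  by (induction A rule: finite_induct) (auto simp: hom_polys_one hom_polys_mult)

lemma hom_polys_power_product:
  assumes "\<And>i. i \<le> m \<Longrightarrow> L i \<in> hom_polys c 1"
  shows "power_product m L \<alpha> \<in> hom_polys c (\<Sum>i\<le>m. \<alpha> i)"
proof -
  have "L i ^ \<alpha> i \<in> hom_polys c (\<alpha> i)" if "i \<in> {..m}" for i
    using hom_polys_power[OF assms, of i "\<alpha> i"] that by simp
  then show ?thesis
    unfolding power_product_def by (intro hom_polys_prod) auto
qed

lemma keys_scale: "Poly_Mapping.keys (mconst a * p) \<subseteq> Poly_Mapping.keys p"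
proof
  fix \<mu> assume \<mu>: "\<mu> \<in> Poly_Mapping.keys (mconst a * p)"
  obtain u v where "\<mu> = u + v" "u \<in> Poly_Mapping.keys (mconst a)" "v \<in> Poly_Mapping.keys p"
    using subsetD[OF keys_mult \<mu>] by blast
  then show "\<mu> \<in> Poly_Mapping.keys p"
    by (auto simp: mconst_def split: if_splits)
qed

lemma keys_linear_combination:
  "Poly_Mapping.keys (\<Sum>x\<in>A. mconst (p x) * f x) \<subseteq> (\<Union>x\<in>A. Poly_Mapping.keys (f x))"
proof -
  have "(\<Union>x\<in>A. Poly_Mapping.keys (mconst (p x) * f x)) \<subseteq> (\<Union>x\<in>A. Poly_Mapping.keys (f x))"
    by (intro UN_mono keys_scale subset_refl)
  then show ?thesis
    using keys_sum[of "\<lambda>x. mconst (p x) * f x" A] by (rule subset_trans[rotated])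
qed

lemma eq_zero_if_disjoint_keys:
  fixes p q :: "'b \<Rightarrow>\<^sub>0 'c::ab_group_add"
  assumes "p + q = 0" "Poly_Mapping.keys p \<inter> Poly_Mapping.keys q = {}"
  shows "p = 0"
proof -
  have "p = - q" using assms(1) by (simp add: eq_neg_iff_add_eq_0)
  then have "Poly_Mapping.keys p = {}"
    using assms(2) by (auto simp: in_keys_iff)
  then show ?thesis
    by (metis in_keys_iff poly_mapping_eqI lookup_zero empty_iff)
qed

text \<open>
  If \<open>q \<noteq> 0\<close>, the polynomial \<open>q\<close> is the initial form of \<open>p\<close>, of weight \<open>s\<close>.
  The case
  \<open>q = 0\<close> occurs: a degenerate form \<open>L' i\<close> may vanish as long as the weight is not known to be
  tropical.
\<close>

definition leading_part :: "('v \<Rightarrow> real) \<Rightarrow> real \<Rightarrow> 'v mpoly \<Rightarrow> 'v mpoly \<Rightarrow> bool" where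
  "leading_part a s p q \<longleftrightarrow>
     (\<forall>\<kappa>\<in>Poly_Mapping.keys q. monomial_weight a \<kappa> = s) \<and>
     (\<forall>\<kappa>\<in>Poly_Mapping.keys (p - q). s < monomial_weight a \<kappa>)"

lemma leading_part_mult:
  assumes "leading_part a s p q" "leading_part a s' p' q'"
  shows "leading_part a (s + s') (p * p') (q * q')"
proof -
  have product: "\<exists>\<mu> \<nu>. \<kappa> = \<mu> + \<nu> \<and> \<mu> \<in> Poly_Mapping.keys f \<and> \<nu> \<in> Poly_Mapping.keys g"
    if "\<kappa> \<in> Poly_Mapping.keys (f * g)" for \<kappa> and f g :: "'a mpoly"
    using subsetD[OF keys_mult that] by blast
  have low: "monomial_weight a \<kappa> = s" if "\<kappa> \<in> Poly_Mapping.keys q" for \<kappa>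
    using assms that by (simp add: leading_part_def)
  have low': "monomial_weight a \<kappa> = s'" if "\<kappa> \<in> Poly_Mapping.keys q'" for \<kappa>
    using assms that by (simp add: leading_part_def)
  have high: "monomial_weight a \<kappa> > s" if "\<kappa> \<in> Poly_Mapping.keys (p - q)" for \<kappa>
    using assms that by (simp add: leading_part_def)
  have high': "monomial_weight a \<kappa> > s'" if "\<kappa> \<in> Poly_Mapping.keys (p' - q')" for \<kappa>
    using assms that by (simp add: leading_part_def)
  have rest: "p * p' - q * q' = q * (p' - q') + (p - q) * q' + (p - q) * (p' - q')"
    by (simp add: algebra_simps)
  show ?thesis
    unfolding leading_part_def
  proof (intro conjI ballI)
    fix \<kappa> assume "\<kappa> \<in> Poly_Mapping.keys (q * q')"
    then obtain \<mu> \<nu> where "\<kappa> = \<mu> + \<nu>" "\<mu> \<in> Poly_Mapping.keys q" "\<nu> \<in> Poly_Mapping.keys q'"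
      using product by blast
    then show "monomial_weight a \<kappa> = s + s'"
      using low low' by (simp add: monomial_weight_add)
  next
    fix \<kappa> assume "\<kappa> \<in> Poly_Mapping.keys (p * p' - q * q')"
    then have "\<kappa> \<in> Poly_Mapping.keys (q * (p' - q')) \<or> \<kappa> \<in> Poly_Mapping.keys ((p - q) * q')
        \<or> \<kappa> \<in> Poly_Mapping.keys ((p - q) * (p' - q'))"
      unfolding rest using subsetD[OF keys_add] by (metis UnE)
    then obtain \<mu> \<nu> where \<kappa>: "\<kappa> = \<mu> + \<nu>"
      and "\<mu> \<in> Poly_Mapping.keys q \<and> \<nu> \<in> Poly_Mapping.keys (p' - q')
        \<or> \<mu> \<in> Poly_Mapping.keys (p - q) \<and> \<nu> \<in> Poly_Mapping.keys q'
        \<or> \<mu> \<in> Poly_Mapping.keys (p - q) \<and> \<nu> \<in> Poly_Mapping.keys (p' - q')"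
      by (elim disjE) (drule product, blast)+
    then show "s + s' < monomial_weight a \<kappa>"
      using low[of \<mu>] low'[of \<nu>] high[of \<mu>] high'[of \<nu>] by (auto simp: monomial_weight_add)
  qed
qed

lemma leading_part_one: "leading_part a 0 1 1"
  by (simp add: leading_part_def)

lemma leading_part_power: "leading_part a s p q \<Longrightarrow> leading_part a (real k * s) (p ^ k) (q ^ k)"
proof (induction k)
  case (Suc k)
  then show ?case using leading_part_mult[of a s p q "real k * s" "p ^ k" "q ^ k"]
    by (simp add: distrib_right)
qed (simp add: leading_part_one)

lemma leading_part_prod:
  "finite A \<Longrightarrow> (\<And>x. x \<in> A \<Longrightarrow> leading_part a (s x) (f x) (g x))
    \<Longrightarrow> leading_part a (sum s A) (prod f A) (prod g A)"
  by (induction A rule: finite_induct) (auto simp: leading_part_one leading_part_mult)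

lemma leading_part_power_product:
  assumes "\<And>i. i \<le> m \<Longrightarrow> leading_part a (a i) (f i) (g i)"
  shows "leading_part a (exponent_weight m a \<alpha>) (power_product m f \<alpha>) (power_product m g \<alpha>)"
  unfolding exponent_weight_def power_product_def
  by (rule leading_part_prod) (use assms in \<open>auto intro: leading_part_power\<close>)

text \<open>
  Greedy choice in the order of decreasing weight: a vector is kept unless it lies in the span of the
  vectors kept before, which have at least its weight.
\<close>

lemma (in vector_space) basis_adapted_to_weight:
  fixes a :: "nat \<Rightarrow> real"
  assumes "finite I"
  shows "\<exists>B\<subseteq>I. inj_on v B \<and> \<not> dependent (v ` B) \<and> (\<forall>i\<in>I. v i \<in> span (v ` {b\<in>B. a i \<le> a b}))"
  using assms
proof (induction I rule: finite_ranking_induct[where f = "\<lambda>i. - a i"])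
  case empty
  then show ?case by (simp add: dependent_def)
next
  case (insert x S)
  then obtain B where B: "B \<subseteq> S" "inj_on v B" "\<not> dependent (v ` B)"
    "\<And>i. i \<in> S \<Longrightarrow> v i \<in> span (v ` {b\<in>B. a i \<le> a b})" by blast
  have least: "a x \<le> a b" if "b \<in> B" for b
    using insert(2)[of b] that B(1) by auto
  show ?case
  proof (cases "v x \<in> span (v ` B)")
    case True
    have "{b\<in>B. a x \<le> a b} = B" using least by auto
    then show ?thesis using B True by (intro exI[of _ B]) auto
  next
    case False
    then have "v x \<notin> v ` B" using span_base by blast
    then have "inj_on v (insert x B)" using B(2) by auto
    moreover have "\<not> dependent (v ` insert x B)"
      using independent_insertI[OF False B(3)] by simp
    moreover have "v i \<in> span (v ` {b \<in> insert x B. a i \<le> a b})" if "i \<in> insert x S" for i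
    proof (cases "i = x")
      case True
      then show ?thesis by (intro span_base) auto
    next
      case False
      then have "v i \<in> span (v ` {b\<in>B. a i \<le> a b})" using that B(4) by auto
      then show ?thesis by (rule rev_subsetD[OF _ span_mono]) auto
    qed
    ultimately show ?thesis using B(1) by (intro exI[of _ "insert x B"]) auto
  qed
qed

lemma total_degree_one:
  assumes "total_degree \<mu> = 1"
  shows "\<exists>j. \<mu> = Poly_Mapping.single j 1"
proof -
  have "sum (Poly_Mapping.lookup \<mu>) (Poly_Mapping.keys \<mu>) = 1"
    using assms by (simp add: total_degree_def)
  then obtain j where j: "j \<in> Poly_Mapping.keys \<mu>" "Poly_Mapping.lookup \<mu> j = 1"
    "\<And>k. k \<in> Poly_Mapping.keys \<mu> \<Longrightarrow> k \<noteq> j \<Longrightarrow> Poly_Mapping.lookup \<mu> k = 0"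
    by (subst (asm) sum_eq_1_iff) (auto simp del: lookup_not_eq_zero_eq_in_keys)
  have "Poly_Mapping.lookup \<mu> k = Poly_Mapping.lookup (Poly_Mapping.single j 1) k" for k
    using j(2) j(3)[of k] by (cases "k = j") (auto simp: lookup_single when_def in_keys_iff)
  then have "\<mu> = Poly_Mapping.single j 1"
    by (intro poly_mapping_eqI)
  then show ?thesis ..
qed

text \<open>
  The basis forms are algebraically independent: as they are linearly independent, some linear map
  sends them to distinct variables, and the substitution \<open>X\<close> that extends this map is a left inverse of
  the substitution of the basis forms for these variables.
\<close>

lemma linear_form_coordinates:
  fixes L :: "nat \<Rightarrow> nat mpoly" and a :: "nat \<Rightarrow> real"
  assumes forms: "\<And>i. i \<le> m \<Longrightarrow> L i \<in> hom_polys c 1"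
  shows "\<exists>B X cf. B \<subseteq> {..m} \<and>
    (\<forall>b\<in>B. eval_mpoly mconst X (L b) = (mvar b :: nat mpoly)) \<and>
    (\<forall>i\<le>m. L i = (\<Sum>b | b \<in> B \<and> a i \<le> a b. mconst (cf i b) * L b))"
proof -
  interpret V: vector_space "\<lambda>z (p :: nat mpoly). mconst z * p"
    by standard (auto simp: mconst_simps algebra_simps)
  interpret VV: vector_space_pair "\<lambda>z (p :: nat mpoly). mconst z * p" "\<lambda>z (p :: nat mpoly). mconst z * p" ..
  obtain B where B: "B \<subseteq> {..m}" "inj_on L B" "\<not> V.dependent (L ` B)"
    "\<And>i. i \<le> m \<Longrightarrow> L i \<in> V.span (L ` {b\<in>B. a i \<le> a b})"
    using V.basis_adapted_to_weight[of "{..m}" L a] by auto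
  have "\<exists>cf. L i = (\<Sum>b | b \<in> B \<and> a i \<le> a b. mconst (cf b) * L b)" if i: "i \<le> m" for i
  proof -
    have fin: "finite (L ` {b\<in>B. a i \<le> a b})" using B(1) by (simp add: finite_subset)
    obtain u where "L i = (\<Sum>v\<in>L ` {b\<in>B. a i \<le> a b}. mconst (u v) * v)"
      using B(4)[OF i] unfolding V.span_finite[OF fin] by auto
    also have "\<dots> = (\<Sum>b | b \<in> B \<and> a i \<le> a b. mconst (u (L b)) * L b)"
      using B(2) by (subst sum.reindex) (auto intro: inj_on_subset)
    finally show ?thesis by (intro exI[of _ "\<lambda>b. u (L b)"])
  qed
  then obtain cf where cf: "\<And>i. i \<le> m \<Longrightarrow> L i = (\<Sum>b | b \<in> B \<and> a i \<le> a b. mconst (cf i b) * L b)"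
    by metis
  obtain g where g: "Vector_Spaces.linear (\<lambda>z p. mconst z * p) (\<lambda>z p. mconst z * p) g"
    "\<And>v. v \<in> L ` B \<Longrightarrow> g v = (mvar (inv_into B L v) :: nat mpoly)"
    using VV.linear_independent_extend[OF B(3), of "\<lambda>v. mvar (inv_into B L v)"] by blast
  interpret g: Vector_Spaces.linear "\<lambda>z p. mconst z * p" "\<lambda>z p. mconst z * p" g by (rule g)
  have "eval_mpoly mconst (\<lambda>j. g (mvar j)) p = g p" if p: "p \<in> hom_polys c 1" for p
  proof -
    have variable: "\<exists>j. \<mu> = Poly_Mapping.single j 1" if "\<mu> \<in> Poly_Mapping.keys p" for \<mu>
    proof -
      have "total_degree \<mu> = 1" using that p by (simp add: hom_polys_iff)
      then show ?thesis by (rule total_degree_one)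
    qed
    have "eval_mpoly mconst (\<lambda>j. g (mvar j)) p = (\<Sum>\<mu>\<in>Poly_Mapping.keys p.
        mconst (Poly_Mapping.lookup p \<mu>) * monomial_value (\<lambda>j. g (mvar j)) \<mu>)"
      by (rule poly.eval_superset) auto
    also have "\<dots> = (\<Sum>\<mu>\<in>Poly_Mapping.keys p.
        g (mconst (Poly_Mapping.lookup p \<mu>) * Poly_Mapping.single \<mu> 1))"
    proof (rule sum.cong)
      fix \<mu> assume "\<mu> \<in> Poly_Mapping.keys p"
      then obtain j where "\<mu> = Poly_Mapping.single j 1" using variable by blast
      then show "mconst (Poly_Mapping.lookup p \<mu>) * monomial_value (\<lambda>j. g (mvar j)) \<mu> =
          g (mconst (Poly_Mapping.lookup p \<mu>) * Poly_Mapping.single \<mu> 1)"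
        by (simp only: g.scale monomial_value_single mvar_def)
    qed simp
    also have "\<dots> = g (\<Sum>\<mu>\<in>Poly_Mapping.keys p. mconst (Poly_Mapping.lookup p \<mu>) * Poly_Mapping.single \<mu> 1)"
      by (rule g.sum[symmetric])
    also have "\<dots> = g p" by (rule arg_cong[where f = g], rule sum_mconst_single[symmetric])
    finally show ?thesis .
  qed
  then have "eval_mpoly mconst (\<lambda>j. g (mvar j)) (L b) = mvar b" if "b \<in> B" for b
    using that forms[of b] B(1,2) g(2)[of "L b"] by auto
  then show ?thesis using B(1) cf
    by (intro exI[of _ B] exI[of _ "\<lambda>j. g (mvar j)"] exI[of _ cf]) simp
qed

lemma eval_mpoly_power_products:
  fixes Q :: "nat mpoly"
  assumes "Q \<in> hom_polys m d"
  shows "eval_mpoly mconst L Q =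
    (\<Sum>\<kappa>\<in>Poly_Mapping.keys Q. mconst (Poly_Mapping.lookup Q \<kappa>) * power_product m L (Poly_Mapping.lookup \<kappa>))"
proof -
  have "monomial_value L \<kappa> = power_product m L (Poly_Mapping.lookup \<kappa>)" if "\<kappa> \<in> Poly_Mapping.keys Q" for \<kappa>
    unfolding power_product_def
    by (rule monomial_value_superset) (use assms that in \<open>auto simp: hom_polys_iff\<close>)
  then show ?thesis by (simp add: poly.eval_superset[of "Poly_Mapping.keys Q"])
qed

text \<open>
  The forms \<open>L'\<close> are a degeneration of the forms \<open>L\<close> along the weights \<open>a\<close>.  Relations between
  products of the forms are stated for families, because different monomials of the presentation can
  have the same image in the homogeneous coordinate ring.  The last clause covers the weights
  \<open>0\<close>, for which the forms are only expressed in other coordinates.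
\<close>

locale linear_degeneration =
  fixes m :: nat and a :: "nat \<Rightarrow> real" and L L' :: "nat \<Rightarrow> nat mpoly"
  assumes initial_relation:
      "\<And>(A :: graded_monomial set) p \<alpha> s. finite A
       \<Longrightarrow> (\<Sum>x\<in>A. mconst (p x) * power_product m L (\<alpha> x)) = 0
       \<Longrightarrow> (\<And>x. x \<in> A \<Longrightarrow> s \<le> exponent_weight m a (\<alpha> x))
       \<Longrightarrow> (\<Sum>x | x \<in> A \<and> exponent_weight m a (\<alpha> x) = s. mconst (p x) * power_product m L' (\<alpha> x)) = 0"
    and graded_relation:
      "\<And>(A :: graded_monomial set) p \<alpha> s. finite A
       \<Longrightarrow> (\<Sum>x\<in>A. mconst (p x) * power_product m L' (\<alpha> x)) = 0
       \<Longrightarrow> (\<Sum>x | x \<in> A \<and> exponent_weight m a (\<alpha> x) = s. mconst (p x) * power_product m L' (\<alpha> x)) = 0"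
    and lift_relation:
      "\<And>(A :: graded_monomial set) p \<alpha> s d. finite A
       \<Longrightarrow> (\<Sum>x\<in>A. mconst (p x) * power_product m L' (\<alpha> x)) = 0
       \<Longrightarrow> (\<And>x. x \<in> A \<Longrightarrow> exponent_weight m a (\<alpha> x) = s)
       \<Longrightarrow> (\<And>x. x \<in> A \<Longrightarrow> (\<Sum>i\<le>m. \<alpha> x i) = d)
       \<Longrightarrow> \<exists>Q\<in>hom_polys m d. (\<forall>\<kappa>\<in>Poly_Mapping.keys Q. s < monomial_weight a \<kappa>) \<and>
             (\<Sum>x\<in>A. mconst (p x) * power_product m L (\<alpha> x)) + eval_mpoly mconst L Q = 0"
    and trivial_weight:
      "(\<forall>i\<le>m. a i = 0) \<Longrightarrow> (\<forall>i\<le>m. L i \<noteq> 0) \<Longrightarrow> i \<le> m \<Longrightarrow> L' i \<noteq> 0"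

text \<open>
  In the coordinates given by an adapted basis, with the variable \<open>z\<^sub>b\<close> of weight \<open>a b\<close>, the form \<open>L i\<close>
  becomes \<open>\<Lambda> i\<close> with lowest part \<open>L' i\<close> of weight \<open>a i\<close>.  Comparing parts of equal weight gives the
  first two properties.  For the third, the expansion of a relation of \<open>L'\<close>, evaluated at \<open>\<Lambda>\<close>, is a
  polynomial \<open>- Q\<close> in the variables \<open>z\<^sub>b\<close> of higher weight; reading \<open>z\<^sub>b\<close> as the variable for the
  form \<open>L b\<close>, the same polynomial provides the correction.
\<close>

lemma exists_linear_degeneration:
  fixes L :: "nat \<Rightarrow> nat mpoly" and a :: "nat \<Rightarrow> real"
  assumes forms: "\<And>i. i \<le> m \<Longrightarrow> L i \<in> hom_polys c 1"
  shows "\<exists>L'. linear_degeneration m a L L'"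
proof -
  have "\<exists>B X cf. B \<subseteq> {..m} \<and>
      (\<forall>b\<in>B. eval_mpoly mconst X (L b) = (mvar b :: nat mpoly)) \<and>
      (\<forall>i\<le>m. L i = (\<Sum>b | b \<in> B \<and> a i \<le> a b. mconst (cf i b) * L b))"
    by (rule linear_form_coordinates) (rule forms)
  then obtain B X cf where coordinates: "B \<subseteq> {..m} \<and>
      (\<forall>b\<in>B. eval_mpoly mconst X (L b) = (mvar b :: nat mpoly)) \<and>
      (\<forall>i\<le>m. L i = (\<Sum>b | b \<in> B \<and> a i \<le> a b. mconst (cf i b) * L b))"
    by (elim exE)
  then have B: "B \<subseteq> {..m}" and X: "\<And>b. b \<in> B \<Longrightarrow> eval_mpoly mconst X (L b) = mvar b"
    by simp_all
  have cf: "L i = (\<Sum>b | b \<in> B \<and> a i \<le> a b. mconst (cf i b) * L b)" if "i \<le> m" for i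
    using coordinates that by blast
  have [simp]: "finite B" using B by (rule finite_subset) simp
  define \<Lambda> where "\<Lambda> i = (\<Sum>b | b \<in> B \<and> a i \<le> a b. mconst (cf i b) * (mvar b :: nat mpoly))" for i
  define L' where "L' i = (\<Sum>b | b \<in> B \<and> a b = a i. mconst (cf i b) * (mvar b :: nat mpoly))" for i
  have to_\<Lambda>: "eval_mpoly mconst X (L i) = \<Lambda> i" if "i \<le> m" for i
    by (subst cf[OF that]) (simp add: \<Lambda>_def poly.eval_sum poly.eval_mult X)
  have from_\<Lambda>: "eval_mpoly mconst L (\<Lambda> i) = L i" if "i \<le> m" for i
    by (subst cf[OF that]) (simp add: \<Lambda>_def poly.eval_sum poly.eval_mult)
  have to_\<Lambda>_prod: "eval_mpoly mconst X (power_product m L \<alpha>) = power_product m \<Lambda> \<alpha>" for \<alpha>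
    by (simp add: power_product_def poly.eval_prod poly.eval_power to_\<Lambda>)
  have from_\<Lambda>_prod: "eval_mpoly mconst L (power_product m \<Lambda> \<alpha>) = power_product m L \<alpha>" for \<alpha>
    by (simp add: power_product_def poly.eval_prod poly.eval_power from_\<Lambda>)
  have weight_mvar: "\<forall>\<kappa>\<in>Poly_Mapping.keys (mvar b :: nat mpoly). monomial_weight a \<kappa> = a b" for b
    by (simp add: mvar_def monomial_weight_def)
  have "leading_part a (a i) (\<Lambda> i) (L' i)" for i
  proof -
    have "{b \<in> B. a i \<le> a b} = {b \<in> B. a b = a i} \<union> {b \<in> B. a i < a b}" by auto
    then have "\<Lambda> i - L' i = (\<Sum>b | b \<in> B \<and> a i < a b. mconst (cf i b) * (mvar b :: nat mpoly))"
      unfolding \<Lambda>_def L'_def by (simp add: sum.union_disjoint disjoint_iff)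
    then have "Poly_Mapping.keys (\<Lambda> i - L' i) \<subseteq> (\<Union>b\<in>{b\<in>B. a i < a b}. Poly_Mapping.keys (mvar b))"
      by (simp only: keys_linear_combination)
    moreover have "Poly_Mapping.keys (L' i) \<subseteq> (\<Union>b\<in>{b\<in>B. a b = a i}. Poly_Mapping.keys (mvar b))"
      unfolding L'_def by (rule keys_linear_combination)
    ultimately show ?thesis
      unfolding leading_part_def using weight_mvar by fastforce
  qed
  then have lead: "leading_part a (exponent_weight m a \<alpha>) (power_product m \<Lambda> \<alpha>) (power_product m L' \<alpha>)" for \<alpha>
    by (intro leading_part_power_product)
  have weight_L': "monomial_weight a \<kappa> = exponent_weight m a \<alpha>"
    if "\<kappa> \<in> Poly_Mapping.keys (power_product m L' \<alpha>)" for \<kappa> \<alpha>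
    using lead that by (auto simp: leading_part_def)
  have weight_rest: "monomial_weight a \<kappa> > exponent_weight m a \<alpha>"
    if "\<kappa> \<in> Poly_Mapping.keys (power_product m \<Lambda> \<alpha> - power_product m L' \<alpha>)" for \<kappa> \<alpha>
    using lead that by (auto simp: leading_part_def)
  have weight_\<Lambda>: "monomial_weight a \<kappa> \<ge> exponent_weight m a \<alpha>"
    if "\<kappa> \<in> Poly_Mapping.keys (power_product m \<Lambda> \<alpha>)" for \<kappa> \<alpha>
  proof -
    have "\<kappa> \<in> Poly_Mapping.keys (power_product m \<Lambda> \<alpha> - power_product m L' \<alpha>) \<or>
        \<kappa> \<in> Poly_Mapping.keys (power_product m L' \<alpha>)"
      using keys_add[of "power_product m \<Lambda> \<alpha> - power_product m L' \<alpha>" "power_product m L' \<alpha>"] that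
      by auto
    then show ?thesis by (elim disjE) (use weight_L' weight_rest in \<open>force+\<close>)
  qed
  have "linear_degeneration m a L L'"
  proof
    fix A :: "graded_monomial set" and p \<alpha> s
    assume fin: "finite A" and zero: "(\<Sum>x\<in>A. mconst (p x) * power_product m L (\<alpha> x)) = 0"
      and low: "\<And>x. x \<in> A \<Longrightarrow> s \<le> exponent_weight m a (\<alpha> x)"
    let ?E = "{x \<in> A. exponent_weight m a (\<alpha> x) = s}"
    let ?G = "{x \<in> A. exponent_weight m a (\<alpha> x) > s}"
    let ?lead = "\<Sum>x\<in>?E. mconst (p x) * power_product m L' (\<alpha> x)"
    let ?rest = "(\<Sum>x\<in>?E. mconst (p x) * (power_product m \<Lambda> (\<alpha> x) - power_product m L' (\<alpha> x)))
      + (\<Sum>x\<in>?G. mconst (p x) * power_product m \<Lambda> (\<alpha> x))"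
    have "A = ?E \<union> ?G" using low by (auto simp: order.order_iff_strict)
    then have "(\<Sum>x\<in>A. mconst (p x) * power_product m \<Lambda> (\<alpha> x)) =
        (\<Sum>x\<in>?E. mconst (p x) * power_product m \<Lambda> (\<alpha> x)) + (\<Sum>x\<in>?G. mconst (p x) * power_product m \<Lambda> (\<alpha> x))"
      using fin by (subst \<open>A = _\<close>, subst sum.union_disjoint) auto
    moreover have "(\<Sum>x\<in>A. mconst (p x) * power_product m \<Lambda> (\<alpha> x)) = 0"
      using arg_cong[OF zero, of "eval_mpoly mconst X"]
      by (simp add: poly.eval_sum poly.eval_mult to_\<Lambda>_prod)
    ultimately have "?lead + ?rest = 0"
      by (simp add: right_diff_distrib sum_subtractf)
    moreover have "Poly_Mapping.keys ?lead \<inter> Poly_Mapping.keys ?rest = {}"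
    proof -
      have "monomial_weight a \<kappa> = s" if "\<kappa> \<in> Poly_Mapping.keys ?lead" for \<kappa>
        using subsetD[OF keys_linear_combination that] by (auto dest: weight_L')
      moreover have "monomial_weight a \<kappa> > s" if \<kappa>: "\<kappa> \<in> Poly_Mapping.keys ?rest" for \<kappa>
      proof -
        consider "\<kappa> \<in> Poly_Mapping.keys (\<Sum>x\<in>?E. mconst (p x) * (power_product m \<Lambda> (\<alpha> x) - power_product m L' (\<alpha> x)))"
          | "\<kappa> \<in> Poly_Mapping.keys (\<Sum>x\<in>?G. mconst (p x) * power_product m \<Lambda> (\<alpha> x))"
          using subsetD[OF keys_add \<kappa>] by blast
        then show ?thesis
        proof cases
          case 1
          show ?thesis using subsetD[OF keys_linear_combination 1] by (auto dest: weight_rest)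
        next
          case 2
          show ?thesis using subsetD[OF keys_linear_combination 2] by (auto dest!: weight_\<Lambda>)
        qed
      qed
      ultimately show ?thesis by fastforce
    qed
    ultimately show "?lead = 0" by (rule eq_zero_if_disjoint_keys)
  next
    fix A :: "graded_monomial set" and p \<alpha> s
    assume fin: "finite A" and zero: "(\<Sum>x\<in>A. mconst (p x) * power_product m L' (\<alpha> x)) = 0"
    let ?E = "{x \<in> A. exponent_weight m a (\<alpha> x) = s}"
    let ?N = "{x \<in> A. exponent_weight m a (\<alpha> x) \<noteq> s}"
    let ?f = "\<lambda>x. mconst (p x) * power_product m L' (\<alpha> x)"
    have "A = ?E \<union> ?N" by auto
    then have "sum ?f ?E + sum ?f ?N = 0"
      using fin zero by (subst sum.union_disjoint[symmetric]) auto
    moreover have "Poly_Mapping.keys (sum ?f ?E) \<inter> Poly_Mapping.keys (sum ?f ?N) = {}"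
    proof -
      have "monomial_weight a \<kappa> = s" if "\<kappa> \<in> Poly_Mapping.keys (sum ?f ?E)" for \<kappa>
        using subsetD[OF keys_linear_combination that] by (auto dest: weight_L')
      moreover have "monomial_weight a \<kappa> \<noteq> s" if "\<kappa> \<in> Poly_Mapping.keys (sum ?f ?N)" for \<kappa>
        using subsetD[OF keys_linear_combination that] by (auto dest: weight_L')
      ultimately show ?thesis by blast
    qed
    ultimately show "sum ?f ?E = 0" by (rule eq_zero_if_disjoint_keys)
  next
    fix A :: "graded_monomial set" and p \<alpha> s d
    assume fin: "finite A" and zero: "(\<Sum>x\<in>A. mconst (p x) * power_product m L' (\<alpha> x)) = 0"
      and weight: "\<And>x. x \<in> A \<Longrightarrow> exponent_weight m a (\<alpha> x) = s"
      and degree: "\<And>x. x \<in> A \<Longrightarrow> (\<Sum>i\<le>m. \<alpha> x i) = d"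
    define Q where "Q = - (\<Sum>x\<in>A. mconst (p x) * power_product m \<Lambda> (\<alpha> x))"
    have "\<Lambda> i \<in> hom_polys m 1" for i
      unfolding \<Lambda>_def using B by (intro hom_polys_sum hom_polys_scale hom_polys_mvar) auto
    then have "Q \<in> hom_polys m d"
      unfolding Q_def using hom_polys_power_product[of m \<Lambda> m] degree
      by (intro hom_polys_minus hom_polys_sum hom_polys_scale) metis
    moreover have "s < monomial_weight a \<kappa>" if \<kappa>: "\<kappa> \<in> Poly_Mapping.keys Q" for \<kappa>
    proof -
      have "Q = - (\<Sum>x\<in>A. mconst (p x) * (power_product m \<Lambda> (\<alpha> x) - power_product m L' (\<alpha> x)))"
        unfolding Q_def using zero by (simp add: right_diff_distrib sum_subtractf)
      then have "\<kappa> \<in> Poly_Mapping.keys (\<Sum>x\<in>A. mconst (p x) * (power_product m \<Lambda> (\<alpha> x) - power_product m L' (\<alpha> x)))"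
        using \<kappa> by (simp add: in_keys_iff)
      from subsetD[OF keys_linear_combination this] show ?thesis
        using weight by (auto dest: weight_rest)
    qed
    moreover have "eval_mpoly mconst L Q = - (\<Sum>x\<in>A. mconst (p x) * power_product m L (\<alpha> x))"
      unfolding Q_def by (simp add: poly.eval_minus poly.eval_sum poly.eval_mult from_\<Lambda>_prod)
    ultimately show "\<exists>Q\<in>hom_polys m d. (\<forall>\<kappa>\<in>Poly_Mapping.keys Q. s < monomial_weight a \<kappa>) \<and>
             (\<Sum>x\<in>A. mconst (p x) * power_product m L (\<alpha> x)) + eval_mpoly mconst L Q = 0"
      by (intro bexI[of _ Q]) auto
  next
    fix i assume "\<forall>i\<le>m. a i = 0" "\<forall>i\<le>m. L i \<noteq> 0" "i \<le> m"
    moreover from this B have "{b \<in> B. a b = a i} = {b \<in> B. a i \<le> a b}" by auto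
    ultimately show "L' i \<noteq> 0"
      using from_\<Lambda>[of i] by (auto simp: L'_def \<Lambda>_def)
  qed
  then show ?thesis by blast
qed

section \<open>The presentation attached to a system of forms\<close>

text \<open>
  The exponents of \<open>t\<^sup>h\<close> as a Laurent monomial in the homogeneous coordinates \<open>x\<^sub>0, \<dots>, x\<^sub>m\<close>, where
  \<open>t\<^sub>i = x\<^sub>i / x\<^sub>0\<close>; their sum is \<open>0\<close>.
\<close>

definition homogeneous_exponent :: "nat \<Rightarrow> lattice_vec \<Rightarrow> nat \<Rightarrow> int" where
  "homogeneous_exponent m h i =
     (if i = 0 then - (\<Sum>j=1..m. Poly_Mapping.lookup h j) else Poly_Mapping.lookup h i)"

lemma homogeneous_exponent_zero [simp]: "homogeneous_exponent m 0 i = 0"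
  by (simp add: homogeneous_exponent_def)

lemma homogeneous_exponent_add:
  "homogeneous_exponent m (g + h) i = homogeneous_exponent m g i + homogeneous_exponent m h i"
  by (simp add: homogeneous_exponent_def lookup_add sum.distrib)

lemma homogeneous_exponent_sum:
  "homogeneous_exponent m (sum f A) i = (\<Sum>x\<in>A. homogeneous_exponent m (f x) i)"
  by (induction A rule: infinite_finite_induct) (auto simp: homogeneous_exponent_add)

lemma atMost_eq_insert_0: "{..m::nat} = insert 0 {1..m}"
  by auto

lemma sum_homogeneous_exponent [simp]: "(\<Sum>i\<le>m. homogeneous_exponent m h i) = 0"
  by (simp add: atMost_eq_insert_0 homogeneous_exponent_def)

lemma homogeneous_exponent_inject:
  assumes "Poly_Mapping.keys g \<subseteq> {1..m}" "Poly_Mapping.keys h \<subseteq> {1..m}"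
    and "\<And>i. i \<le> m \<Longrightarrow> homogeneous_exponent m g i = homogeneous_exponent m h i"
  shows "g = h"
proof (rule poly_mapping_eqI)
  fix i
  show "Poly_Mapping.lookup g i = Poly_Mapping.lookup h i"
  proof (cases "i \<in> {1..m}")
    case True
    then show ?thesis using assms(3)[of i] by (simp add: homogeneous_exponent_def)
  next
    case False
    then have "i \<notin> Poly_Mapping.keys g" "i \<notin> Poly_Mapping.keys h" using assms(1,2) by auto
    then show ?thesis by (simp add: in_keys_iff)
  qed
qed

lemma homogeneous_exponent_surj:
  assumes "(\<Sum>i\<le>m. e i) = 0"
  obtains h where "Poly_Mapping.keys h \<subseteq> {1..m}" "\<And>i. i \<le> m \<Longrightarrow> homogeneous_exponent m h i = e i"
proof
  let ?h = "\<Sum>j=1..m. Poly_Mapping.single j (e j)"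
  have lookup: "Poly_Mapping.lookup ?h i = (if i \<in> {1..m} then e i else 0)" for i
    by (simp add: lookup_sum lookup_single when_def)
  show "Poly_Mapping.keys ?h \<subseteq> {1..m}"
    by (auto simp: in_keys_iff lookup simp del: One_nat_def split: if_splits)
  fix i assume "i \<le> m"
  then show "homogeneous_exponent m ?h i = e i"
    using assms by (simp add: homogeneous_exponent_def lookup atMost_eq_insert_0 del: One_nat_def)
qed

text \<open>
  The toric presentation with the coordinates replaced by arbitrary forms.  The case \<open>L = mvar\<close> is the
  toric presentation itself, and the given system of linear forms leads to the presentation of the
  coordinate ring; it will also be used for degenerations of that system.
\<close>

definition arrangement_presentation ::
  "nat \<Rightarrow> (nat \<Rightarrow> nat mpoly) \<Rightarrow> (lattice_vec \<times> lattice_vec) mpoly \<Rightarrow> (lattice_vec \<Rightarrow>\<^sub>0 ratfun)" where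
  "arrangement_presentation m L =
     eval_mpoly (\<lambda>a. Poly_Mapping.single 0 (Fract (mconst a) 1))
       (\<lambda>(h, h'). Poly_Mapping.single h'
          (\<Prod>i=1..m. Fract (L i) (L 0) powi Poly_Mapping.lookup h i))"

lemma Fract_1_simps:
  "Fract (p + q) 1 = Fract p 1 + Fract q (1 :: nat mpoly)"
  "Fract (p * q) 1 = Fract p 1 * Fract q (1 :: nat mpoly)"
  "Fract (0 :: nat mpoly) 1 = 0" "Fract (1 :: nat mpoly) 1 = 1"
  by (simp_all add: Zero_fract_def One_fract_def)

lemma Fract_1_eq_0_iff: "Fract p 1 = 0 \<longleftrightarrow> p = (0 :: nat mpoly)"
  by (simp add: Zero_fract_def eq_fract)

lemma Fract_1_power: "Fract (p ^ k) 1 = Fract p (1 :: nat mpoly) ^ k"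
  by (induction k) (auto simp: Fract_1_simps simp del: mult_fract)

lemma Fract_1_sum: "Fract (sum f A) 1 = (\<Sum>x\<in>A. Fract (f x) (1 :: nat mpoly))"
  by (induction A rule: infinite_finite_induct) (auto simp: Fract_1_simps simp del: add_fract)

lemma Fract_1_prod: "Fract (prod f A) 1 = (\<Prod>x\<in>A. Fract (f x) (1 :: nat mpoly))"
  by (induction A rule: infinite_finite_induct) (auto simp: Fract_1_simps simp del: mult_fract)

lemma Fract_eq_divide: "q \<noteq> 0 \<Longrightarrow> Fract p q = Fract p 1 / Fract (q :: nat mpoly) 1"
  by simp

interpretation laurent: coefficient_hom
  "\<lambda>a. Poly_Mapping.single 0 (Fract (mconst a) 1) :: lattice_vec \<Rightarrow>\<^sub>0 ratfun"
  by standard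
     (simp_all add: mconst_simps mult_single Fract_1_simps single_add del: mult_fract add_fract)

lemma prod_power_int_const:
  fixes x :: "'a::field"
  assumes "x \<noteq> 0" "finite A"
  shows "(\<Prod>j\<in>A. x powi f j) = x powi (\<Sum>j\<in>A. f j)"
  using assms(2) by (induction A rule: finite_induct) (auto simp: assms(1) power_int_add)

lemma torus_character_homogeneous:
  fixes L :: "nat \<Rightarrow> nat mpoly"
  assumes nonzero: "\<And>i. i \<le> m \<Longrightarrow> L i \<noteq> 0"
  shows "(\<Prod>i=1..m. Fract (L i) (L 0) powi Poly_Mapping.lookup h i) =
    (\<Prod>i\<le>m. Fract (L i) 1 powi homogeneous_exponent m h i)"
proof -
  have ne: "Fract (L 0) 1 \<noteq> (0 :: ratfun)" using nonzero[of 0] by (simp add: Fract_1_eq_0_iff)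
  have "(\<Prod>i=1..m. Fract (L i) (L 0) powi Poly_Mapping.lookup h i) =
      (\<Prod>i=1..m. Fract (L i) 1 powi Poly_Mapping.lookup h i / Fract (L 0) 1 powi Poly_Mapping.lookup h i)"
    using nonzero[of 0] by (simp only: Fract_eq_divide power_int_divide_distrib le0 not_False_eq_True)
  also have "\<dots> = (\<Prod>i=1..m. Fract (L i) 1 powi Poly_Mapping.lookup h i) /
      Fract (L 0) 1 powi (\<Sum>i=1..m. Poly_Mapping.lookup h i)"
    by (simp only: prod_dividef prod_power_int_const[OF ne finite_atLeastAtMost])
  also have "\<dots> = (\<Prod>i\<le>m. Fract (L i) 1 powi homogeneous_exponent m h i)"
    by (simp add: atMost_eq_insert_0 homogeneous_exponent_def power_int_minus divide_inverse mult.commute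
        del: mult_fract divide_fract inverse_fract)
  finally show ?thesis .
qed

lemma presentation_single:
  assumes nonzero: "\<And>i. i \<le> m \<Longrightarrow> L i \<noteq> 0"
  shows "arrangement_presentation m L (Poly_Mapping.single \<mu> a) =
    Poly_Mapping.single (character_degree \<mu>) (Fract (mconst a) 1 *
      (\<Prod>i\<le>m. Fract (L i) 1 powi homogeneous_exponent m (torus_degree \<mu>) i))"
proof -
  define \<theta> :: "lattice_vec \<times> lattice_vec \<Rightarrow> (lattice_vec \<Rightarrow>\<^sub>0 ratfun)" where
    "\<theta> = (\<lambda>(h, u). Poly_Mapping.single u (\<Prod>i\<le>m. Fract (L i) 1 powi homogeneous_exponent m h i))"
  have "\<theta> 0 = 1" by (simp add: \<theta>_def zero_prod_def)
  moreover have "\<theta> (x + y) = \<theta> x * \<theta> y" for x y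
    using nonzero
    by (auto simp: \<theta>_def mult_single homogeneous_exponent_add power_int_add Fract_1_eq_0_iff prod.distrib
        split: prod.split simp del: mult_fract)
  ultimately have "monomial_value \<theta> \<mu> = \<theta> (monomial_degree \<mu>)"
    by (rule monomial_value_character)
  moreover have "(\<lambda>(h, h'). Poly_Mapping.single h'
      (\<Prod>i=1..m. Fract (L i) (L 0) powi Poly_Mapping.lookup h i)) = \<theta>"
    unfolding \<theta>_def by (simp only: torus_character_homogeneous[of m L, OF nonzero])
  ultimately show ?thesis
    unfolding arrangement_presentation_def laurent.eval_single
    by (simp add: \<theta>_def mult_single split_beta del: mult_fract)
qed

text \<open>
  Exponents relative to lower bounds \<open>\<beta>\<close>: multiplication by the product of the powers of the \<open>L i\<close>
  with exponents \<open>- \<beta> i\<close> clears the denominators.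
\<close>

definition shifted_exponent ::
  "nat \<Rightarrow> (nat \<Rightarrow> int) \<Rightarrow> graded_monomial \<Rightarrow> nat \<Rightarrow> nat" where
  "shifted_exponent m \<beta> \<mu> i = nat (homogeneous_exponent m (torus_degree \<mu>) i - \<beta> i)"

text \<open>
  The coefficient of a character becomes, after clearing denominators, a combination of products
  of the forms, and therefore polynomial relations between the forms decide whether it vanishes.
\<close>

lemma presentation_coefficient:
  assumes nonzero: "\<And>i. i \<le> m \<Longrightarrow> L i \<noteq> 0" and fin: "finite A"
    and bound: "\<And>x i. x \<in> A \<Longrightarrow> character_degree (\<rho> x) = u \<Longrightarrow> i \<le> m \<Longrightarrow>
      \<beta> i \<le> homogeneous_exponent m (torus_degree (\<rho> x)) i"
  shows "Poly_Mapping.lookup (arrangement_presentation m L (\<Sum>x\<in>A. Poly_Mapping.single (\<rho> x) (a x))) u =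
    (\<Prod>i\<le>m. Fract (L i) 1 powi \<beta> i) *
    Fract (\<Sum>x | x \<in> A \<and> character_degree (\<rho> x) = u.
      mconst (a x) * power_product m L (shifted_exponent m \<beta> (\<rho> x))) 1"
proof -
  let ?A = "{x \<in> A. character_degree (\<rho> x) = u}"
  let ?e = "\<lambda>x. homogeneous_exponent m (torus_degree (\<rho> x))"
  have "Poly_Mapping.lookup (arrangement_presentation m L (\<Sum>x\<in>A. Poly_Mapping.single (\<rho> x) (a x))) u =
      (\<Sum>x\<in>A. Poly_Mapping.lookup (arrangement_presentation m L (Poly_Mapping.single (\<rho> x) (a x))) u)"
    by (simp add: arrangement_presentation_def laurent.eval_sum lookup_sum)
  also have "\<dots> = (\<Sum>x\<in>A. if character_degree (\<rho> x) = u then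
      Fract (mconst (a x)) 1 * (\<Prod>i\<le>m. Fract (L i) 1 powi ?e x i) else 0)"
    by (simp add: presentation_single[OF nonzero] lookup_single when_def del: mult_fract)
  also have "\<dots> = (\<Sum>x\<in>?A. Fract (mconst (a x)) 1 * (\<Prod>i\<le>m. Fract (L i) 1 powi ?e x i))"
    using fin by (simp add: sum.If_cases Int_def)
  also have "\<dots> = (\<Sum>x\<in>?A. (\<Prod>i\<le>m. Fract (L i) 1 powi \<beta> i) *
      Fract (mconst (a x) * power_product m L (shifted_exponent m \<beta> (\<rho> x))) 1)"
  proof (rule sum.cong)
    fix x assume x: "x \<in> ?A"
    have "Fract (L i) 1 powi ?e x i =
        Fract (L i) 1 powi \<beta> i * Fract (L i) 1 ^ shifted_exponent m \<beta> (\<rho> x) i" if "i \<in> {..m}" for i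
    proof -
      have "?e x i = \<beta> i + int (shifted_exponent m \<beta> (\<rho> x) i)"
        using bound[of x i] x that by (simp add: shifted_exponent_def)
      then show ?thesis
        using nonzero[of i] that by (simp add: power_int_add Fract_1_eq_0_iff del: mult_fract)
    qed
    then have "(\<Prod>i\<le>m. Fract (L i) 1 powi ?e x i) = (\<Prod>i\<le>m. Fract (L i) 1 powi \<beta> i) *
        (\<Prod>i\<le>m. Fract (L i) 1 ^ shifted_exponent m \<beta> (\<rho> x) i)"
      by (simp only: prod.distrib[symmetric] cong: prod.cong)
    then show "Fract (mconst (a x)) 1 * (\<Prod>i\<le>m. Fract (L i) 1 powi ?e x i) =
        (\<Prod>i\<le>m. Fract (L i) 1 powi \<beta> i) *
        Fract (mconst (a x) * power_product m L (shifted_exponent m \<beta> (\<rho> x))) 1"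
      by (simp add: power_product_def Fract_1_simps(2) Fract_1_prod Fract_1_power mult_ac del: mult_fract)
  qed simp
  finally show ?thesis
    by (simp only: Fract_1_sum sum_distrib_left)
qed

lemma presentation_coefficient_eq_0_iff:
  assumes nonzero: "\<And>i. i \<le> m \<Longrightarrow> L i \<noteq> 0" and fin: "finite A"
    and bound: "\<And>x i. x \<in> A \<Longrightarrow> character_degree (\<rho> x) = u \<Longrightarrow> i \<le> m \<Longrightarrow>
      \<beta> i \<le> homogeneous_exponent m (torus_degree (\<rho> x)) i"
  shows "Poly_Mapping.lookup (arrangement_presentation m L (\<Sum>x\<in>A. Poly_Mapping.single (\<rho> x) (a x))) u = 0
    \<longleftrightarrow> (\<Sum>x | x \<in> A \<and> character_degree (\<rho> x) = u.
          mconst (a x) * power_product m L (shifted_exponent m \<beta> (\<rho> x))) = 0"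
proof -
  have "(\<Prod>i\<le>m. Fract (L i) 1 powi \<beta> i) \<noteq> (0 :: ratfun)"
    using nonzero by (simp add: Fract_1_eq_0_iff)
  then show ?thesis
    by (subst presentation_coefficient[where \<beta> = \<beta>])
       (use nonzero fin bound in \<open>auto simp: Fract_1_eq_0_iff\<close>)
qed

lemma exists_lower_bound:
  assumes "finite A"
  shows "\<exists>N::nat. \<forall>x\<in>A. - int N \<le> g x"
proof -
  have "- int (\<Sum>y\<in>A. nat \<bar>g y\<bar>) \<le> g x" if "x \<in> A" for x
  proof -
    have "nat \<bar>g x\<bar> \<le> (\<Sum>y\<in>A. nat \<bar>g y\<bar>)"
      by (rule member_le_sum) (use assms that in auto)
    then show ?thesis by linarith
  qed
  then show ?thesis by blast
qed

lemma exponent_lower_bound: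
  assumes "finite A"
  obtains N :: nat where
    "\<And>\<mu> i. \<mu> \<in> A \<Longrightarrow> i \<le> m \<Longrightarrow> - int N \<le> homogeneous_exponent m (torus_degree \<mu>) i"
  using exists_lower_bound[of "A \<times> {..m}" "\<lambda>(\<mu>, i). homogeneous_exponent m (torus_degree \<mu>) i"] assms
  by fastforce

definition arrangement_ideal ::
  "(lattice_vec \<times> lattice_vec) set \<Rightarrow> nat \<Rightarrow> (nat \<Rightarrow> nat mpoly) \<Rightarrow> (lattice_vec \<times> lattice_vec) mpoly set" where
  "arrangement_ideal H m L = {p \<in> carrier (mpoly_ring H). arrangement_presentation m L p = 0}"

text \<open>
  The target of the presentation is a group algebra of a totally ordered abelian group over a field,
  hence a domain.
\<close>

lemma primeideal_arrangement_ideal: "primeideal (arrangement_ideal H m L) (mpoly_ring H)"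
proof (rule primeidealI)
  show "ideal (arrangement_ideal H m L) (mpoly_ring H)"
    by (rule mpoly_ring_idealI)
       (auto simp: arrangement_ideal_def arrangement_presentation_def carrier_add carrier_mult
         laurent.eval_add laurent.eval_mult, simp add: mpoly_ring_simps)
  show "cring (mpoly_ring H)" by (rule cring_mpoly_ring)
  have "1 \<in> carrier (mpoly_ring H) - arrangement_ideal H m L"
    by (auto simp: arrangement_ideal_def arrangement_presentation_def mpoly_ring_simps)
  then show "carrier (mpoly_ring H) \<noteq> arrangement_ideal H m L" by blast
next
  fix p q assume "p \<in> carrier (mpoly_ring H)" "q \<in> carrier (mpoly_ring H)"
    "p \<otimes>\<^bsub>mpoly_ring H\<^esub> q \<in> arrangement_ideal H m L"
  then show "p \<in> arrangement_ideal H m L \<or> q \<in> arrangement_ideal H m L"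
    by (auto simp: arrangement_ideal_def arrangement_presentation_def laurent.eval_mult mpoly_ring_simps(4))
qed

lemma mvar_nonzero: "mvar v \<noteq> 0"
  by (metis mvar_def lookup_single_eq lookup_zero zero_neq_one)

lemma mvar_notin_arrangement_ideal:
  assumes "\<And>i. i \<le> m \<Longrightarrow> L i \<noteq> 0"
  shows "mvar v \<notin> arrangement_ideal H m L"
proof -
  have "arrangement_presentation m L (mvar v) \<noteq> 0"
  proof
    assume "arrangement_presentation m L (mvar v) = 0"
    then have "Poly_Mapping.lookup (arrangement_presentation m L (mvar v)) (snd v) = 0" by simp
    then show False
      using assms by (simp add: mvar_def presentation_single Fract_1_eq_0_iff mconst_simps del: mult_fract)
  qed
  then show ?thesis by (simp add: arrangement_ideal_def)
qed

text \<open>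
  Independence of the chosen fraction: substitution of \<open>L\<close> preserves the polynomial identity that
  expresses equality of two fractions.
\<close>

lemma restrict_ratfun_Fract:
  assumes "q \<noteq> 0" "eval_mpoly mconst L q \<noteq> 0"
  shows "restrict_ratfun L (Fract p q) = Fract (eval_mpoly mconst L p) (eval_mpoly mconst L q)"
  unfolding restrict_ratfun_def
proof (rule the_equality)
  fix g assume "\<exists>p' q'. q' \<noteq> 0 \<and> eval_mpoly mconst L q' \<noteq> 0 \<and> Fract p q = Fract p' q' \<and>
      g = Fract (eval_mpoly mconst L p') (eval_mpoly mconst L q')"
  then obtain p' q' where *: "q' \<noteq> 0" "eval_mpoly mconst L q' \<noteq> 0" "Fract p q = Fract p' q'"
    "g = Fract (eval_mpoly mconst L p') (eval_mpoly mconst L q')" by blast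
  then have "p * q' = p' * q" using assms by (simp add: eq_fract)
  then have "eval_mpoly mconst L p * eval_mpoly mconst L q' = eval_mpoly mconst L p' * eval_mpoly mconst L q"
    by (metis poly.eval_mult)
  then show "g = Fract (eval_mpoly mconst L p) (eval_mpoly mconst L q)"
    using * assms by (simp add: eq_fract)
qed (use assms in blast)

lemma restrict_sections_eq_0_iff:
  "restrict_sections L g = 0 \<longleftrightarrow> (\<forall>u. restrict_ratfun L (Poly_Mapping.lookup g u) = 0)"
proof -
  have "restrict_ratfun L 0 = 0"
    using restrict_ratfun_Fract[of 1 L 0] by (simp add: Fract_1_simps)
  then show ?thesis
    unfolding restrict_sections_def map_eq_zero_iff
    by (metis in_keys_iff)
qed

text \<open>
  Coefficients of the toric presentation have monomials as denominators, and these do not vanish on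
  the image of the embedding; so restriction just substitutes \<open>L\<close>.
\<close>

lemma semi_canonical_ideal_eq:
  assumes nonzero: "\<And>i. i \<le> m \<Longrightarrow> L i \<noteq> 0"
  shows "semi_canonical_ideal n \<sigma> c m L \<Delta> H = arrangement_ideal H m L"
proof -
  have "restrict_ratfun L (Poly_Mapping.lookup (toric_presentation m p) u) = 0 \<longleftrightarrow>
      Poly_Mapping.lookup (arrangement_presentation m L p) u = 0" for p u
  proof -
    obtain N :: nat where N: "\<And>\<mu> i. \<mu> \<in> Poly_Mapping.keys p \<Longrightarrow> i \<le> m \<Longrightarrow>
        - int N \<le> homogeneous_exponent m (torus_degree \<mu>) i"
      using exponent_lower_bound[OF finite_keys] by blast
    let ?sum = "\<lambda>L. \<Sum>\<mu> | \<mu> \<in> Poly_Mapping.keys p \<and> character_degree \<mu> = u.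
        mconst (Poly_Mapping.lookup p \<mu>) * power_product m L (shifted_exponent m (\<lambda>i. - int N) \<mu>)"
    have "toric_presentation m p = arrangement_presentation m mvar p"
      by (simp add: toric_presentation_def arrangement_presentation_def)
    also have "Poly_Mapping.lookup \<dots> u = (\<Prod>i\<le>m. Fract (mvar i) 1 powi (- int N)) * Fract (?sum mvar) 1"
      by (subst poly_mapping_sum_singles[of p], subst presentation_coefficient[where \<beta> = "\<lambda>i. - int N"])
         (use N in \<open>auto simp: mvar_nonzero\<close>)
    also have "\<dots> = Fract (?sum mvar) 1 / Fract (\<Prod>i\<le>m. mvar i ^ N) 1"
      by (simp only: power_int_minus power_int_of_nat prod_inversef[unfolded comp_def] Fract_1_prod Fract_1_power
          divide_inverse mult.commute)
    finally have toric: "Poly_Mapping.lookup (toric_presentation m p) u = Fract (?sum mvar) (\<Prod>i\<le>m. mvar i ^ N)"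
      by simp
    have denominator: "(\<Prod>i\<le>m. mvar i ^ N :: nat mpoly) \<noteq> 0"
      by (simp add: mvar_nonzero)
    have "eval_mpoly mconst L (\<Prod>i\<le>m. mvar i ^ N) = (\<Prod>i\<le>m. L i ^ N)"
      by (simp add: poly.eval_prod poly.eval_power)
    moreover have "eval_mpoly mconst L (?sum mvar) = ?sum L"
      by (simp add: poly.eval_sum poly.eval_mult poly.eval_power poly.eval_prod power_product_def)
    moreover have "(\<Prod>i\<le>m. L i ^ N) \<noteq> 0" using nonzero by simp
    ultimately have "restrict_ratfun L (Poly_Mapping.lookup (toric_presentation m p) u) =
        Fract (?sum L) (\<Prod>i\<le>m. L i ^ N)"
      unfolding toric using denominator by (subst restrict_ratfun_Fract) simp_all
    moreover have "Poly_Mapping.lookup (arrangement_presentation m L p) u = 0 \<longleftrightarrow> ?sum L = 0"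
      by (subst poly_mapping_sum_singles[of p],
          subst presentation_coefficient_eq_0_iff[where \<beta> = "\<lambda>i. - int N", OF nonzero])
         (use N in auto)
    ultimately show ?thesis
      using \<open>(\<Prod>i\<le>m. L i ^ N) \<noteq> 0\<close> by (simp add: Zero_fract_def eq_fract)
  qed
  then have "restrict_sections L (toric_presentation m p) = 0 \<longleftrightarrow> arrangement_presentation m L p = 0" for p
    unfolding restrict_sections_eq_0_iff by (simp add: poly_mapping_eq_iff fun_eq_iff)
  then show ?thesis
    by (simp add: semi_canonical_ideal_def a_kernel_def' arrangement_ideal_def section_ring_def)
qed

section \<open>Initial forms\<close>

lemma lookup_sum_single_restrict:
  assumes "A \<subseteq> Poly_Mapping.keys p"
  shows "Poly_Mapping.lookup (\<Sum>\<mu>\<in>A. Poly_Mapping.single \<mu> (Poly_Mapping.lookup p \<mu>)) \<nu> =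
    (if \<nu> \<in> A then Poly_Mapping.lookup p \<nu> else 0)"
  using finite_subset[OF assms finite_keys] by (simp add: lookup_sum lookup_single when_def)

lemma keys_sum_single_restrict:
  assumes "A \<subseteq> Poly_Mapping.keys p"
  shows "Poly_Mapping.keys (\<Sum>\<mu>\<in>A. Poly_Mapping.single \<mu> (Poly_Mapping.lookup p \<mu>)) = A"
  using subsetD[OF assms] lookup_sum_single_restrict[OF assms] by (auto simp: in_keys_iff split: if_splits)

lemma initial_form_add_higher:
  assumes "f \<noteq> 0" and f: "\<And>\<mu>. \<mu> \<in> Poly_Mapping.keys f \<Longrightarrow> monomial_weight w \<mu> = s"
    and g: "\<And>\<mu>. \<mu> \<in> Poly_Mapping.keys g \<Longrightarrow> s < monomial_weight w \<mu>"
  shows "initial_form w (f + g) = f"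
proof -
  have disjoint: "\<mu> \<notin> Poly_Mapping.keys g" if "\<mu> \<in> Poly_Mapping.keys f" for \<mu>
    using f[OF that] g[of \<mu>] by auto
  then have lookup: "Poly_Mapping.lookup (f + g) \<mu> = Poly_Mapping.lookup f \<mu>"
    if "\<mu> \<in> Poly_Mapping.keys f" for \<mu>
    using that by (simp add: lookup_add in_keys_iff)
  then have sub: "Poly_Mapping.keys f \<subseteq> Poly_Mapping.keys (f + g)"
    by (auto simp: in_keys_iff)
  have ge: "s \<le> monomial_weight w \<nu>" if "\<nu> \<in> Poly_Mapping.keys (f + g)" for \<nu>
    using subsetD[OF keys_add that] f g by fastforce
  obtain \<mu>0 where \<mu>0: "\<mu>0 \<in> Poly_Mapping.keys f"
    using \<open>f \<noteq> 0\<close> by (metis in_keys_iff lookup_zero poly_mapping_eqI)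
  have "{\<mu>. \<mu> \<in> Poly_Mapping.keys (f + g) \<and>
      (\<forall>\<nu>\<in>Poly_Mapping.keys (f + g). monomial_weight w \<mu> \<le> monomial_weight w \<nu>)} = Poly_Mapping.keys f"
  proof (intro equalityI subsetI)
    fix \<mu> assume \<mu>: "\<mu> \<in> {\<mu>. \<mu> \<in> Poly_Mapping.keys (f + g) \<and>
      (\<forall>\<nu>\<in>Poly_Mapping.keys (f + g). monomial_weight w \<mu> \<le> monomial_weight w \<nu>)}"
    then have "monomial_weight w \<mu> \<le> s" using f[OF \<mu>0] \<mu>0 sub by auto
    then have "\<mu> \<notin> Poly_Mapping.keys g" using g[of \<mu>] by auto
    then show "\<mu> \<in> Poly_Mapping.keys f" using \<mu> keys_add[of f g] by auto
  qed (use sub ge f in auto)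
  then have "initial_form w (f + g) = (\<Sum>\<mu>\<in>Poly_Mapping.keys f. Poly_Mapping.single \<mu> (Poly_Mapping.lookup (f + g) \<mu>))"
    by (simp add: initial_form_def)
  also have "\<dots> = (\<Sum>\<mu>\<in>Poly_Mapping.keys f. Poly_Mapping.single \<mu> (Poly_Mapping.lookup f \<mu>))"
    by (simp add: lookup)
  also have "\<dots> = f" by (rule poly_mapping_sum_singles[symmetric])
  finally show ?thesis .
qed

lemma initial_form_in_carrier:
  assumes "f \<in> carrier (mpoly_ring V)"
  shows "initial_form w f \<in> carrier (mpoly_ring V)"
  unfolding initial_form_def
  by (rule carrier_sum, rule carrier_single) (use assms in \<open>auto simp: mpoly_ring_simps\<close>)

lemma
  assumes "I \<subseteq> carrier (mpoly_ring V)"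
  shows ideal_initial_ideal: "ideal (initial_ideal V w I) (mpoly_ring V)"
    and initial_form_in_initial_ideal: "f \<in> I \<Longrightarrow> initial_form w f \<in> initial_ideal V w I"
proof -
  interpret cring "mpoly_ring V" by (rule cring_mpoly_ring)
  have sub: "initial_form w ` I \<subseteq> carrier (mpoly_ring V)"
    using assms initial_form_in_carrier by blast
  show "ideal (initial_ideal V w I) (mpoly_ring V)"
    unfolding initial_ideal_def using sub by (rule genideal_ideal)
  show "initial_form w f \<in> initial_ideal V w I" if "f \<in> I"
    unfolding initial_ideal_def using genideal_self[OF sub] that by blast
qed

lemma initial_ideal_minimal:
  assumes "ideal K (mpoly_ring V)" "\<And>f. f \<in> I \<Longrightarrow> initial_form w f \<in> K"
  shows "initial_ideal V w I \<subseteq> K"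
proof -
  interpret cring "mpoly_ring V" by (rule cring_mpoly_ring)
  show ?thesis unfolding initial_ideal_def
    by (rule genideal_minimal) (use assms in auto)
qed

section \<open>Tropical weights\<close>

text \<open>
  A monoid all of whose slices with fixed \<open>u\<close> are defined by separate lower bounds on the homogeneous
  exponents: a vector belongs to the slice as soon as each of its homogeneous exponents is at least
  the corresponding exponent of some element, which may depend on the coordinate.
\<close>

locale box_closed_monoid =
  fixes m :: nat and H S :: "(lattice_vec \<times> lattice_vec) set"
  assumes generated: "S = monomial_degree ` {\<mu>. Poly_Mapping.keys \<mu> \<subseteq> H}"
    and support: "(h, u) \<in> S \<Longrightarrow> Poly_Mapping.keys h \<subseteq> {1..m}"
    and box: "Poly_Mapping.keys h \<subseteq> {1..m} \<Longrightarrow>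
      (\<And>i. i \<le> m \<Longrightarrow> \<exists>h'. (h', u) \<in> S \<and> homogeneous_exponent m h' i \<le> homogeneous_exponent m h i) \<Longrightarrow>
      (h, u) \<in> S"
begin

text \<open>
  Bounds such that all \<open>h\<close> with homogeneous exponents at least \<open>\<beta>\<close> belong to the slice of \<open>u\<close>.  If the
  sum of \<open>\<beta>\<close> is \<open>- d\<close>, these \<open>h\<close> correspond to the monomials of degree \<open>d\<close> in \<open>x\<^sub>0, \<dots>, x\<^sub>m\<close>.
\<close>

definition admissible :: "lattice_vec \<Rightarrow> (nat \<Rightarrow> int) \<Rightarrow> bool" where
  "admissible u \<beta> \<longleftrightarrow> (\<forall>i\<le>m. \<exists>h. (h, u) \<in> S \<and> homogeneous_exponent m h i \<le> \<beta> i)"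

text \<open>
  On each slice the weight is affine with slope \<open>a\<close>.  Adding a constant to \<open>a\<close> changes nothing, as
  homogeneous exponents have sum \<open>0\<close>.
\<close>

definition adapted :: "((lattice_vec \<times> lattice_vec) \<Rightarrow> real) \<Rightarrow> (nat \<Rightarrow> real) \<Rightarrow> bool" where
  "adapted w a \<longleftrightarrow> (\<forall>\<mu> \<nu>. Poly_Mapping.keys \<mu> \<subseteq> H \<longrightarrow> Poly_Mapping.keys \<nu> \<subseteq> H \<longrightarrow>
     character_degree \<mu> = character_degree \<nu> \<longrightarrow>
     monomial_weight w \<nu> - monomial_weight w \<mu> =
       (\<Sum>i\<le>m. a i * (homogeneous_exponent m (torus_degree \<nu>) i - homogeneous_exponent m (torus_degree \<mu>) i)))"

lemma degree_in_monoid: "Poly_Mapping.keys \<mu> \<subseteq> H \<Longrightarrow> (torus_degree \<mu>, character_degree \<mu>) \<in> S"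
  unfolding generated by (simp add: image_iff) blast

lemma admissible_realized:
  assumes "admissible u \<beta>" "\<And>i. i \<le> m \<Longrightarrow> \<beta> i \<le> e i" "(\<Sum>i\<le>m. e i) = 0"
  shows "\<exists>\<rho>. Poly_Mapping.keys \<rho> \<subseteq> H \<and> character_degree \<rho> = u \<and>
    (\<forall>i\<le>m. homogeneous_exponent m (torus_degree \<rho>) i = e i)"
proof -
  obtain h where h: "Poly_Mapping.keys h \<subseteq> {1..m}" "\<And>i. i \<le> m \<Longrightarrow> homogeneous_exponent m h i = e i"
    using homogeneous_exponent_surj[OF assms(3)] by blast
  have "(h, u) \<in> S"
  proof (rule box[OF h(1)])
    fix i assume "i \<le> m"
    then show "\<exists>h'. (h', u) \<in> S \<and> homogeneous_exponent m h' i \<le> homogeneous_exponent m h i"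
      using assms(1,2) h(2) unfolding admissible_def by (metis order_trans)
  qed
  then obtain \<rho> where "Poly_Mapping.keys \<rho> \<subseteq> H" "monomial_degree \<rho> = (h, u)"
    unfolding generated by force
  then show ?thesis using h(2) by auto
qed

text \<open>
  If a slice contains two elements, then some bounds \<open>\<beta>\<close> of sum \<open>- 1\<close> are admissible, so the slice
  contains the vectors with exponents \<open>\<beta> + e\<^sub>i\<close> for the unit vectors \<open>e\<^sub>i\<close>; their weights serve as
  \<open>a i\<close>.  To compare two elements of another slice, with exponents \<open>b + \<alpha>\<close> and \<open>b + \<alpha>'\<close> for
  nonnegative \<open>\<alpha>\<close> and \<open>\<alpha>'\<close> of the same sum, add to the first one \<open>\<alpha>'\<^sub>i\<close> times the vector \<open>\<beta> + e\<^sub>i\<close>,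
  for all \<open>i\<close>, and to the second one \<open>\<alpha>\<^sub>i\<close> times the same vectors: the totals agree, and additivity of
  the weight gives the claim.  If no slice contains two elements, the weights \<open>0\<close> do.
\<close>

lemma adapted_if_degree_weight:
  assumes weight: "\<And>\<mu> \<nu>. Poly_Mapping.keys \<mu> \<subseteq> H \<Longrightarrow> Poly_Mapping.keys \<nu> \<subseteq> H \<Longrightarrow>
      monomial_degree \<mu> = monomial_degree \<nu> \<Longrightarrow> monomial_weight w \<mu> = monomial_weight w \<nu>"
  shows "\<exists>a. adapted w a \<and>
    ((\<forall>i. a i = 0) \<or> (\<exists>u \<beta>. admissible u \<beta> \<and> (\<Sum>i\<le>m. \<beta> i) = - 1))"
proof (cases "\<forall>h h' u. (h, u) \<in> S \<longrightarrow> (h', u) \<in> S \<longrightarrow> h = h'")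
  case True
  have "adapted w (\<lambda>_. 0)"
    unfolding adapted_def
  proof (intro allI impI)
    fix \<mu> \<nu> assume *: "Poly_Mapping.keys \<mu> \<subseteq> H" "Poly_Mapping.keys \<nu> \<subseteq> H" "character_degree \<mu> = character_degree \<nu>"
    then have "torus_degree \<mu> = torus_degree \<nu>"
      using True degree_in_monoid[of \<mu>] degree_in_monoid[of \<nu>] by metis
    then show "monomial_weight w \<nu> - monomial_weight w \<mu> = (\<Sum>i\<le>m. 0 *
        real_of_int (homogeneous_exponent m (torus_degree \<nu>) i - homogeneous_exponent m (torus_degree \<mu>) i))"
      using weight[of \<mu> \<nu>] * by (simp add: prod_eq_iff)
  qed
  then show ?thesis by (intro exI[of _ "\<lambda>_. 0"]) simp
next
  case False
  then obtain h1 h2 u0 where h12: "(h1, u0) \<in> S" "(h2, u0) \<in> S" "h1 \<noteq> h2" by blast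
  let ?e = "homogeneous_exponent m"
  define \<gamma> where "\<gamma> i = min (?e h1 i) (?e h2 i)" for i
  have \<gamma>: "(\<Sum>i\<le>m. \<gamma> i) < 0"
  proof -
    obtain i where i: "i \<le> m" "?e h1 i \<noteq> ?e h2 i"
      using homogeneous_exponent_inject[of h1 m h2] support h12 by blast
    have "(\<Sum>i\<le>m. \<gamma> i) \<noteq> 0"
    proof
      assume zero: "(\<Sum>i\<le>m. \<gamma> i) = 0"
      have eq: "\<gamma> i = ?e h i" if "\<And>j. \<gamma> j \<le> ?e h j" for h
      proof -
        have "(\<Sum>j\<le>m. ?e h j - \<gamma> j) = 0" by (simp add: sum_subtractf zero)
        then show ?thesis
          using that i(1) by (subst (asm) sum_nonneg_eq_0_iff) auto
      qed
      have "\<gamma> i = ?e h1 i" "\<gamma> i = ?e h2 i" by (rule eq, simp add: \<gamma>_def)+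
      then show False using i(2) by simp
    qed
    moreover have "(\<Sum>i\<le>m. \<gamma> i) \<le> (\<Sum>i\<le>m. ?e h1 i)"
      by (rule sum_mono) (simp add: \<gamma>_def)
    ultimately show ?thesis by simp
  qed
  \<comment> \<open>Raising \<open>\<gamma>\<close> in the coordinate \<open>0\<close> preserves admissibility and makes the sum equal to \<open>- 1\<close>.\<close>
  define \<beta> where "\<beta> i = (if i = 0 then \<gamma> 0 - 1 - (\<Sum>i\<le>m. \<gamma> i) else \<gamma> i)" for i
  have sum_\<beta>: "(\<Sum>i\<le>m. \<beta> i) = - 1"
  proof -
    have "(\<Sum>i\<le>m. \<beta> i) = \<beta> 0 + (\<Sum>i=1..m. \<beta> i)" by (simp add: atMost_eq_insert_0)
    also have "(\<Sum>i=1..m. \<beta> i) = (\<Sum>i=1..m. \<gamma> i)" by (rule sum.cong) (auto simp: \<beta>_def)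
    also have "\<beta> 0 = \<gamma> 0 - 1 - (\<gamma> 0 + (\<Sum>i=1..m. \<gamma> i))" by (simp add: \<beta>_def atMost_eq_insert_0)
    finally show ?thesis by simp
  qed
  have "\<gamma> i \<le> \<beta> i" for i using \<gamma> by (simp add: \<beta>_def)
  moreover have "?e h1 i \<le> \<gamma> i \<or> ?e h2 i \<le> \<gamma> i" for i by (auto simp: \<gamma>_def)
  ultimately have adm: "admissible u0 \<beta>"
    unfolding admissible_def using h12 by (meson order_trans)
  have "\<exists>\<rho>. Poly_Mapping.keys \<rho> \<subseteq> H \<and> character_degree \<rho> = u0 \<and>
      (\<forall>j\<le>m. ?e (torus_degree \<rho>) j = \<beta> j + (if j = i then 1 else 0))" if "i \<le> m" for i
    by (rule admissible_realized[OF adm]) (use that sum_\<beta> in \<open>auto simp: sum.distrib\<close>)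
  then obtain \<rho> where \<rho>: "\<And>i. i \<le> m \<Longrightarrow> Poly_Mapping.keys (\<rho> i) \<subseteq> H"
    "\<And>i. i \<le> m \<Longrightarrow> character_degree (\<rho> i) = u0"
    "\<And>i j. i \<le> m \<Longrightarrow> j \<le> m \<Longrightarrow> ?e (torus_degree (\<rho> i)) j = \<beta> j + (if j = i then 1 else 0)"
    by metis
  define a where "a i = monomial_weight w (\<rho> i)" for i
  have "adapted w a"
    unfolding adapted_def
  proof (intro allI impI)
    fix \<mu> \<nu> assume \<mu>: "Poly_Mapping.keys \<mu> \<subseteq> H" and \<nu>: "Poly_Mapping.keys \<nu> \<subseteq> H"
      and u: "character_degree \<mu> = character_degree \<nu>"
    define b where "b i = min (?e (torus_degree \<mu>) i) (?e (torus_degree \<nu>) i)" for i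
    define \<alpha> where "\<alpha> \<mu> i = nat (?e (torus_degree \<mu>) i - b i)" for \<mu> i
    have \<alpha>: "int (\<alpha> \<mu> i) = ?e (torus_degree \<mu>) i - b i" "int (\<alpha> \<nu> i) = ?e (torus_degree \<nu>) i - b i" for i
      by (auto simp: \<alpha>_def b_def)
    have "int (\<Sum>i\<le>m. \<alpha> \<mu> i) = int (\<Sum>i\<le>m. \<alpha> \<nu> i)"
      by (simp add: \<alpha> sum_subtractf)
    then have total: "(\<Sum>i\<le>m. \<alpha> \<mu> i) = (\<Sum>i\<le>m. \<alpha> \<nu> i)" by linarith
    define \<tau> where "\<tau> \<alpha> = (\<Sum>i\<le>m. \<Sum>k<(\<alpha> i :: nat). \<rho> i)" for \<alpha>
    have \<tau>_keys: "Poly_Mapping.keys (\<tau> \<alpha>) \<subseteq> H" for \<alpha>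
    proof -
      have "Poly_Mapping.keys (\<Sum>k<(j::nat). \<rho> i) \<subseteq> H" if "i \<le> m" for i j
        using \<rho>(1)[OF that] by (intro subset_trans[OF keys_sum]) auto
      then show ?thesis
        unfolding \<tau>_def by (intro subset_trans[OF keys_sum]) auto
    qed
    have \<tau>_character: "character_degree (\<tau> \<alpha>) = (\<Sum>k<sum \<alpha> {..m}. u0)" for \<alpha>
      by (simp add: \<tau>_def monomial_degree_sum snd_sum \<rho>(2) del: sum_constant flip: sum_sum_lessThan_const)
    have \<tau>_exponent: "?e (torus_degree (\<tau> \<alpha>)) j = int (sum \<alpha> {..m}) * \<beta> j + int (\<alpha> j)" if "j \<le> m" for \<alpha> j
    proof -
      have "?e (torus_degree (\<tau> \<alpha>)) j = (\<Sum>i\<le>m. int (\<alpha> i) * (\<beta> j + (if j = i then 1 else 0)))"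
        using that
        by (simp add: \<tau>_def monomial_degree_sum fst_sum homogeneous_exponent_sum \<rho>(3) del: sum_constant)
          simp
      also have "\<dots> = (\<Sum>i\<le>m. int (\<alpha> i) * \<beta> j + (if j = i then int (\<alpha> i) else 0))"
        by (rule sum.cong) (auto simp: algebra_simps)
      also have "\<dots> = int (sum \<alpha> {..m}) * \<beta> j + int (\<alpha> j)"
        using that by (simp add: sum.distrib sum_distrib_right)
      finally show ?thesis .
    qed
    have \<tau>_weight: "monomial_weight w (\<tau> \<alpha>) = (\<Sum>i\<le>m. real (\<alpha> i) * a i)" for \<alpha>
      by (simp add: \<tau>_def monomial_weight_sum a_def del: sum_constant) simp
    have keys: "Poly_Mapping.keys (\<mu> + \<tau> (\<alpha> \<nu>)) \<subseteq> H" "Poly_Mapping.keys (\<nu> + \<tau> (\<alpha> \<mu>)) \<subseteq> H"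
      using \<mu> \<nu> \<tau>_keys by (auto dest!: subsetD[OF keys_add])
    have "character_degree (\<mu> + \<tau> (\<alpha> \<nu>)) = character_degree (\<nu> + \<tau> (\<alpha> \<mu>))"
      by (simp add: monomial_degree_add \<tau>_character u total)
    moreover have "torus_degree (\<mu> + \<tau> (\<alpha> \<nu>)) = torus_degree (\<nu> + \<tau> (\<alpha> \<mu>))"
    proof (rule homogeneous_exponent_inject)
      show "Poly_Mapping.keys (torus_degree (\<mu> + \<tau> (\<alpha> \<nu>))) \<subseteq> {1..m}"
        "Poly_Mapping.keys (torus_degree (\<nu> + \<tau> (\<alpha> \<mu>))) \<subseteq> {1..m}"
        using degree_in_monoid[OF keys(1)] degree_in_monoid[OF keys(2)] support by blast+
      fix i assume "i \<le> m"
      then show "?e (torus_degree (\<mu> + \<tau> (\<alpha> \<nu>))) i = ?e (torus_degree (\<nu> + \<tau> (\<alpha> \<mu>))) i"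
        by (simp add: monomial_degree_add homogeneous_exponent_add \<tau>_exponent total \<alpha>)
    qed
    ultimately have "monomial_weight w (\<mu> + \<tau> (\<alpha> \<nu>)) = monomial_weight w (\<nu> + \<tau> (\<alpha> \<mu>))"
      by (intro weight keys prod_eqI)
    then have "monomial_weight w \<nu> - monomial_weight w \<mu> = (\<Sum>i\<le>m. a i * (real (\<alpha> \<nu> i) - real (\<alpha> \<mu> i)))"
      by (simp add: monomial_weight_add \<tau>_weight right_diff_distrib sum_subtractf mult.commute)
    moreover have "real (\<alpha> \<nu> i) - real (\<alpha> \<mu> i) = ?e (torus_degree \<nu>) i - ?e (torus_degree \<mu>) i" for i
    proof -
      have "int (\<alpha> \<nu> i) - int (\<alpha> \<mu> i) = ?e (torus_degree \<nu>) i - ?e (torus_degree \<mu>) i" by (simp add: \<alpha>)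
      then show ?thesis by (metis of_int_diff of_int_of_nat_eq)
    qed
    ultimately show "monomial_weight w \<nu> - monomial_weight w \<mu> =
       (\<Sum>i\<le>m. a i * (?e (torus_degree \<nu>) i - ?e (torus_degree \<mu>) i))"
      by (simp only:)
  qed
  then show ?thesis using adm sum_\<beta> by blast
qed

text \<open>
  The difference of two monomials of equal degree lies in the ideal.  If their weights were different,
  its initial form would be a monomial.
\<close>

lemma weight_factors_through_degree:
  assumes "w \<in> Trop H (arrangement_ideal H m L)" and nonzero: "\<And>i. i \<le> m \<Longrightarrow> L i \<noteq> 0"
    and \<mu>: "Poly_Mapping.keys \<mu> \<subseteq> H" and \<nu>: "Poly_Mapping.keys \<nu> \<subseteq> H"
    and deg: "monomial_degree \<mu> = monomial_degree \<nu>"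
  shows "monomial_weight w \<mu> \<le> monomial_weight w \<nu>"
proof (rule ccontr)
  assume "\<not> monomial_weight w \<mu> \<le> monomial_weight w \<nu>"
  then have less: "monomial_weight w \<nu> < monomial_weight w \<mu>" by simp
  let ?f = "Poly_Mapping.single \<nu> 1 :: (lattice_vec \<times> lattice_vec) mpoly"
  let ?g = "Poly_Mapping.single \<mu> (- 1) :: (lattice_vec \<times> lattice_vec) mpoly"
  have "arrangement_presentation m L (?f + ?g) =
      arrangement_presentation m L ?f + arrangement_presentation m L ?g"
    by (simp add: arrangement_presentation_def laurent.eval_add)
  also have "\<dots> = Poly_Mapping.single (character_degree \<nu>)
      ((Fract (mconst 1) 1 + Fract (mconst (- 1)) 1) *
       (\<Prod>i\<le>m. Fract (L i) 1 powi homogeneous_exponent m (torus_degree \<nu>) i))"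
    by (simp only: presentation_single[OF nonzero] deg single_add[symmetric] distrib_right)
  also have "Fract (mconst 1) 1 + Fract (mconst (- 1)) 1 = (0 :: ratfun)"
    by (simp add: mconst_simps flip: Fract_1_simps(1)) (simp add: Fract_1_simps)
  finally have "?f + ?g \<in> arrangement_ideal H m L"
    unfolding arrangement_ideal_def using \<mu> \<nu> by (simp add: carrier_add carrier_single)
  then have "initial_form w (?f + ?g) \<in> initial_ideal H w (arrangement_ideal H m L)"
    by (intro initial_form_in_initial_ideal) (auto simp: arrangement_ideal_def)
  also have "initial_form w (?f + ?g) = ?f"
    by (rule initial_form_add_higher[where s = "monomial_weight w \<nu>"])
       (use less in \<open>auto split: if_splits dest: arg_cong[where f = "\<lambda>p. Poly_Mapping.lookup p \<nu>"]\<close>)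
  finally show False using assms(1) \<nu> by (auto simp: Trop_def)
qed

end

section \<open>The initial ideals of an arrangement ideal\<close>

context box_closed_monoid
begin

lemma adapted_weight_shifted:
  assumes "adapted w a" "Poly_Mapping.keys \<mu> \<subseteq> H" "Poly_Mapping.keys \<nu> \<subseteq> H"
    "character_degree \<mu> = character_degree \<nu>"
    and "\<And>i. i \<le> m \<Longrightarrow> \<beta> i \<le> homogeneous_exponent m (torus_degree \<mu>) i"
    and "\<And>i. i \<le> m \<Longrightarrow> \<beta> i \<le> homogeneous_exponent m (torus_degree \<nu>) i"
  shows "monomial_weight w \<nu> - monomial_weight w \<mu> =
    exponent_weight m a (shifted_exponent m \<beta> \<nu>) - exponent_weight m a (shifted_exponent m \<beta> \<mu>)"
proof -
  have "exponent_weight m a (shifted_exponent m \<beta> \<nu>) - exponent_weight m a (shifted_exponent m \<beta> \<mu>) =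
      (\<Sum>i\<le>m. real (shifted_exponent m \<beta> \<nu> i) * a i - real (shifted_exponent m \<beta> \<mu> i) * a i)"
    by (simp add: exponent_weight_def sum_subtractf)
  also have "\<dots> = (\<Sum>i\<le>m. a i *
      (homogeneous_exponent m (torus_degree \<nu>) i - homogeneous_exponent m (torus_degree \<mu>) i))"
    by (rule sum.cong) (use assms(5,6) in \<open>auto simp: shifted_exponent_def algebra_simps\<close>)
  finally show ?thesis using assms(1-4) by (simp add: adapted_def)
qed

text \<open>
  The monomials of \<open>Q\<close> lift to monomials of character degree \<open>u\<close>, because \<open>\<beta>\<close> is admissible.
  The resulting polynomial \<open>g\<close> has higher weight than \<open>f\<close>, and \<open>f + g\<close> belongs to the ideal by the
  relation, so that \<open>f\<close> is its initial form.
\<close>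

lemma in_initial_ideal_if_relation:
  assumes nonzero: "\<And>i. i \<le> m \<Longrightarrow> L i \<noteq> 0" and "adapted w a" and "f \<noteq> 0"
    and f: "f \<in> carrier (mpoly_ring H)" and adm: "admissible u \<beta>"
    and character: "\<And>\<mu>. \<mu> \<in> Poly_Mapping.keys f \<Longrightarrow> character_degree \<mu> = u"
    and bound: "\<And>\<mu> i. \<mu> \<in> Poly_Mapping.keys f \<Longrightarrow> i \<le> m \<Longrightarrow> \<beta> i \<le> homogeneous_exponent m (torus_degree \<mu>) i"
    and weight: "\<And>\<mu>. \<mu> \<in> Poly_Mapping.keys f \<Longrightarrow> monomial_weight w \<mu> = s"
    and Q: "Q \<in> hom_polys m d" and degree: "(\<Sum>i\<le>m. \<beta> i) = - int d"
    and high: "\<And>\<mu> \<kappa>. \<mu> \<in> Poly_Mapping.keys f \<Longrightarrow> \<kappa> \<in> Poly_Mapping.keys Q \<Longrightarrow>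
      exponent_weight m a (shifted_exponent m \<beta> \<mu>) < monomial_weight a \<kappa>"
    and relation: "(\<Sum>\<mu>\<in>Poly_Mapping.keys f. mconst (Poly_Mapping.lookup f \<mu>) *
      power_product m L (shifted_exponent m \<beta> \<mu>)) + eval_mpoly mconst L Q = 0"
  shows "f \<in> initial_ideal H w (arrangement_ideal H m L)"
proof -
  obtain \<mu>0 where \<mu>0: "\<mu>0 \<in> Poly_Mapping.keys f"
    using \<open>f \<noteq> 0\<close> by (metis in_keys_iff lookup_zero poly_mapping_eqI)
  have keys_f: "Poly_Mapping.keys \<mu> \<subseteq> H" if "\<mu> \<in> Poly_Mapping.keys f" for \<mu>
    using f that by (simp add: mpoly_ring_simps)
  have \<kappa>: "Poly_Mapping.keys \<kappa> \<subseteq> {..m}" "(\<Sum>i\<le>m. Poly_Mapping.lookup \<kappa> i) = d"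
    if "\<kappa> \<in> Poly_Mapping.keys Q" for \<kappa>
  proof -
    show keys: "Poly_Mapping.keys \<kappa> \<subseteq> {..m}" using Q that by (simp add: hom_polys_iff)
    show "(\<Sum>i\<le>m. Poly_Mapping.lookup \<kappa> i) = d"
      using Q that total_degree_superset[OF _ keys] by (simp add: hom_polys_iff)
  qed
  have "\<exists>\<rho>. Poly_Mapping.keys \<rho> \<subseteq> H \<and> character_degree \<rho> = u \<and>
    (\<forall>i\<le>m. homogeneous_exponent m (torus_degree \<rho>) i = \<beta> i + int (Poly_Mapping.lookup \<kappa> i))"
    if "\<kappa> \<in> Poly_Mapping.keys Q" for \<kappa>
  proof (rule admissible_realized[OF adm])
    have "(\<Sum>i\<le>m. int (Poly_Mapping.lookup \<kappa> i)) = int d"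
      using \<kappa>(2)[OF that] by (simp flip: of_nat_sum)
    then show "(\<Sum>i\<le>m. \<beta> i + int (Poly_Mapping.lookup \<kappa> i)) = 0"
      by (simp add: sum.distrib degree)
  qed simp
  then obtain \<rho> where \<rho>: "\<And>\<kappa>. \<kappa> \<in> Poly_Mapping.keys Q \<Longrightarrow> Poly_Mapping.keys (\<rho> \<kappa>) \<subseteq> H"
    "\<And>\<kappa>. \<kappa> \<in> Poly_Mapping.keys Q \<Longrightarrow> character_degree (\<rho> \<kappa>) = u"
    "\<And>\<kappa> i. \<kappa> \<in> Poly_Mapping.keys Q \<Longrightarrow> i \<le> m \<Longrightarrow>
      homogeneous_exponent m (torus_degree (\<rho> \<kappa>)) i = \<beta> i + int (Poly_Mapping.lookup \<kappa> i)"
    by metis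
  define g where "g = (\<Sum>\<kappa>\<in>Poly_Mapping.keys Q. Poly_Mapping.single (\<rho> \<kappa>) (Poly_Mapping.lookup Q \<kappa>))"
  have shifted: "shifted_exponent m \<beta> (\<rho> \<kappa>) i = Poly_Mapping.lookup \<kappa> i"
    if "\<kappa> \<in> Poly_Mapping.keys Q" "i \<le> m" for \<kappa> i
    using \<rho>(3)[OF that] by (simp add: shifted_exponent_def)
  have g_carrier: "g \<in> carrier (mpoly_ring H)"
    unfolding g_def by (intro carrier_sum carrier_single \<rho>(1))
  have g_weight: "s < monomial_weight w \<nu>" if \<nu>: "\<nu> \<in> Poly_Mapping.keys g" for \<nu>
  proof -
    have "\<nu> \<in> (\<Union>\<kappa>\<in>Poly_Mapping.keys Q. Poly_Mapping.keys (Poly_Mapping.single (\<rho> \<kappa>) (Poly_Mapping.lookup Q \<kappa>)))"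
      using \<nu> keys_sum unfolding g_def by (rule rev_subsetD)
    then obtain \<kappa> where \<kappa>_Q: "\<kappa> \<in> Poly_Mapping.keys Q" and "\<nu> = \<rho> \<kappa>"
      by (auto split: if_splits)
    have "monomial_weight w (\<rho> \<kappa>) - monomial_weight w \<mu>0 =
        exponent_weight m a (shifted_exponent m \<beta> (\<rho> \<kappa>)) - exponent_weight m a (shifted_exponent m \<beta> \<mu>0)"
      by (rule adapted_weight_shifted[OF \<open>adapted w a\<close>])
         (use \<kappa>_Q \<mu>0 keys_f \<rho> character bound in auto)
    moreover have "exponent_weight m a (shifted_exponent m \<beta> (\<rho> \<kappa>)) = monomial_weight a \<kappa>"
      using \<kappa>(1)[OF \<kappa>_Q] shifted[OF \<kappa>_Q]
      by (simp add: exponent_weight_def monomial_weight_superset[of "{..m}"])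
    ultimately show ?thesis
      using high[OF \<mu>0 \<kappa>_Q] weight[OF \<mu>0] \<open>\<nu> = \<rho> \<kappa>\<close> by simp
  qed
  have "Poly_Mapping.lookup (arrangement_presentation m L (f + g)) v = 0" for v
  proof -
    let ?c = "\<Prod>i\<le>m. Fract (L i) 1 powi \<beta> i :: ratfun"
    let ?F = "\<Sum>\<mu>\<in>Poly_Mapping.keys f. mconst (Poly_Mapping.lookup f \<mu>) * power_product m L (shifted_exponent m \<beta> \<mu>)"
    let ?G = "\<Sum>\<kappa>\<in>Poly_Mapping.keys Q. mconst (Poly_Mapping.lookup Q \<kappa>) *
      power_product m L (shifted_exponent m \<beta> (\<rho> \<kappa>))"
    have F: "Poly_Mapping.lookup (arrangement_presentation m L f) v = ?c * Fract (if v = u then ?F else 0) 1"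
    proof -
      have "{\<mu> \<in> Poly_Mapping.keys f. character_degree \<mu> = v} = (if v = u then Poly_Mapping.keys f else {})"
        using character by auto
      then show ?thesis
        by (subst poly_mapping_sum_singles[of f], subst presentation_coefficient[where \<beta> = \<beta>])
           (use nonzero bound in auto)
    qed
    have G: "Poly_Mapping.lookup (arrangement_presentation m L g) v = ?c * Fract (if v = u then ?G else 0) 1"
    proof -
      have "{\<kappa> \<in> Poly_Mapping.keys Q. character_degree (\<rho> \<kappa>) = v} = (if v = u then Poly_Mapping.keys Q else {})"
        using \<rho>(2) by auto
      then show ?thesis
        unfolding g_def
        by (subst presentation_coefficient[where \<beta> = \<beta>]) (use nonzero \<rho>(3) in auto)
    qed
    have "?G = eval_mpoly mconst L Q"
      unfolding eval_mpoly_power_products[OF Q]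
      by (rule sum.cong) (auto simp: power_product_def shifted)
    then have "?F + ?G = 0" using relation by simp
    then have zero: "Fract ?F 1 + Fract ?G 1 = (0 :: ratfun)"
      by (simp only: Fract_1_simps(1)[symmetric] Fract_1_simps(3))
    have "Poly_Mapping.lookup (arrangement_presentation m L (f + g)) v =
        Poly_Mapping.lookup (arrangement_presentation m L f) v + Poly_Mapping.lookup (arrangement_presentation m L g) v"
      by (simp add: arrangement_presentation_def laurent.eval_add lookup_add)
    also have "\<dots> = ?c * (Fract (if v = u then ?F else 0) 1 + Fract (if v = u then ?G else 0) 1)"
      by (simp only: F G distrib_left)
    also have "\<dots> = 0"
    proof (cases "v = u")
      case True
      then show ?thesis by (simp only: simp_thms if_True zero mult_zero_right)
    next
      case False
      then show ?thesis by (simp only: if_False Fract_1_simps(3) add_0_right mult_zero_right)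
    qed
    finally show ?thesis .
  qed
  then have "arrangement_presentation m L (f + g) = 0"
    by (intro poly_mapping_eqI) simp
  then have "f + g \<in> arrangement_ideal H m L"
    using f g_carrier by (simp add: arrangement_ideal_def carrier_add)
  then have "initial_form w (f + g) \<in> initial_ideal H w (arrangement_ideal H m L)"
    by (intro initial_form_in_initial_ideal) (auto simp: arrangement_ideal_def)
  also have "initial_form w (f + g) = f"
    using \<open>f \<noteq> 0\<close> weight g_weight by (rule initial_form_add_higher)
  finally show ?thesis .
qed

end

locale arrangement_degeneration = box_closed_monoid m H S + linear_degeneration m a L L'
  for m H S a L L' +
  fixes w :: "(lattice_vec \<times> lattice_vec) \<Rightarrow> real"
  assumes nonzero: "i \<le> m \<Longrightarrow> L i \<noteq> 0" and adapted: "adapted w a"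
begin

text \<open>
  All monomials of \<open>f\<close> have the same weight and the same total degree once the exponents are taken
  relative to \<open>\<beta>\<close>, so the relation satisfied by \<open>f\<close> among the \<open>L'\<close> lifts to one among the \<open>L\<close>.
\<close>

lemma homogeneous_part_in_initial_ideal:
  assumes f: "f \<in> carrier (mpoly_ring H)" and adm: "admissible u \<beta>"
    and character: "\<And>\<mu>. \<mu> \<in> Poly_Mapping.keys f \<Longrightarrow> character_degree \<mu> = u"
    and bound: "\<And>\<mu> i. \<mu> \<in> Poly_Mapping.keys f \<Longrightarrow> i \<le> m \<Longrightarrow>
      \<beta> i \<le> homogeneous_exponent m (torus_degree \<mu>) i"
    and weight: "\<And>\<mu>. \<mu> \<in> Poly_Mapping.keys f \<Longrightarrow> monomial_weight w \<mu> = s"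
    and zero: "(\<Sum>\<mu>\<in>Poly_Mapping.keys f. mconst (Poly_Mapping.lookup f \<mu>) *
      power_product m L' (shifted_exponent m \<beta> \<mu>)) = 0"
  shows "f \<in> initial_ideal H w (arrangement_ideal H m L)"
proof (cases "f = 0")
  case True
  have "ideal (initial_ideal H w (arrangement_ideal H m L)) (mpoly_ring H)"
    by (rule ideal_initial_ideal) (auto simp: arrangement_ideal_def)
  then show ?thesis using True ideal_closed(1) by blast
next
  case False
  then obtain \<mu>0 where \<mu>0: "\<mu>0 \<in> Poly_Mapping.keys f"
    by (metis in_keys_iff lookup_zero poly_mapping_eqI)
  define d where "d = (\<Sum>i\<le>m. shifted_exponent m \<beta> \<mu>0 i)"
  have degree: "int (\<Sum>i\<le>m. shifted_exponent m \<beta> \<mu> i) = - (\<Sum>i\<le>m. \<beta> i)"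
    if "\<mu> \<in> Poly_Mapping.keys f" for \<mu>
  proof -
    have "int (\<Sum>i\<le>m. shifted_exponent m \<beta> \<mu> i) = (\<Sum>i\<le>m. homogeneous_exponent m (torus_degree \<mu>) i - \<beta> i)"
      unfolding of_nat_sum
      by (rule sum.cong) (use bound[OF that] in \<open>auto simp: shifted_exponent_def\<close>)
    then show ?thesis by (simp add: sum_subtractf)
  qed
  have same_weight: "exponent_weight m a (shifted_exponent m \<beta> \<mu>) = exponent_weight m a (shifted_exponent m \<beta> \<mu>0)"
    if "\<mu> \<in> Poly_Mapping.keys f" for \<mu>
    using adapted_weight_shifted[OF adapted, of \<mu>0 \<mu> \<beta>] f that \<mu>0 character bound weight
    by (simp add: mpoly_ring_simps)
  have same_degree: "(\<Sum>i\<le>m. shifted_exponent m \<beta> \<mu> i) = d" if "\<mu> \<in> Poly_Mapping.keys f" for \<mu>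
    using degree[OF that] degree[OF \<mu>0] unfolding d_def by linarith
  obtain Q where Q: "Q \<in> hom_polys m d"
    "\<forall>\<kappa>\<in>Poly_Mapping.keys Q. exponent_weight m a (shifted_exponent m \<beta> \<mu>0) < monomial_weight a \<kappa>"
    "(\<Sum>\<mu>\<in>Poly_Mapping.keys f. mconst (Poly_Mapping.lookup f \<mu>) *
      power_product m L (shifted_exponent m \<beta> \<mu>)) + eval_mpoly mconst L Q = 0"
    using lift_relation[OF finite_keys zero same_weight same_degree] by blast
  show ?thesis
    by (rule in_initial_ideal_if_relation[OF nonzero adapted False f adm character bound weight Q(1)])
       (use Q(2,3) same_weight degree[OF \<mu>0] in \<open>auto simp: d_def\<close>)
qed

text \<open>
  Bounds of sum \<open>- 1\<close> leave room for single variables: if \<open>L' i = 0\<close>, the monomial that corresponds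
  to \<open>x\<^sub>i\<close> satisfies the hypotheses of the previous lemma, against tropicality of \<open>w\<close>.
\<close>

lemma degenerate_form_nonzero:
  assumes trop: "w \<in> Trop H (arrangement_ideal H m L)"
    and adm: "admissible u \<beta>" and sum_\<beta>: "(\<Sum>i\<le>m. \<beta> i) = - 1" and i: "i \<le> m"
  shows "L' i \<noteq> 0"
proof -
  let ?e = "\<lambda>\<mu>. homogeneous_exponent m (torus_degree \<mu>)"
  have "\<exists>\<rho>. Poly_Mapping.keys \<rho> \<subseteq> H \<and> character_degree \<rho> = u \<and>
      (\<forall>j\<le>m. ?e \<rho> j = \<beta> j + (if j = i then 1 else 0))"
    by (rule admissible_realized[OF adm]) (use i sum_\<beta> in \<open>auto simp: sum.distrib\<close>)
  then obtain \<rho> where \<rho>: "Poly_Mapping.keys \<rho> \<subseteq> H" "character_degree \<rho> = u"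
    "\<And>j. j \<le> m \<Longrightarrow> ?e \<rho> j = \<beta> j + (if j = i then 1 else 0)" by blast
  show ?thesis
  proof
    assume "L' i = 0"
    have "shifted_exponent m \<beta> \<rho> i = 1" using \<rho>(3)[OF i] by (simp add: shifted_exponent_def)
    then have "power_product m L' (shifted_exponent m \<beta> \<rho>) = 0"
      unfolding power_product_def using i \<open>L' i = 0\<close> by (intro prod_zero) auto
    then have "Poly_Mapping.single \<rho> 1 \<in> initial_ideal H w (arrangement_ideal H m L)"
      by (intro homogeneous_part_in_initial_ideal[OF _ adm]) (use \<rho> in \<open>auto simp: carrier_single\<close>)
    then show False using trop \<rho>(1) by (auto simp: Trop_def)
  qed
qed

text \<open>
  The initial form selects, in each character degree, the terms of lowest weight of a relation among
  the \<open>L\<close>, or no terms at all.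
\<close>

lemma initial_form_in_degenerate_ideal:
  assumes nonzero': "\<And>i. i \<le> m \<Longrightarrow> L' i \<noteq> 0" and f: "f \<in> arrangement_ideal H m L"
  shows "initial_form w f \<in> arrangement_ideal H m L'"
proof -
  let ?e = "\<lambda>\<mu>. homogeneous_exponent m (torus_degree \<mu>)"
  have f_carrier: "f \<in> carrier (mpoly_ring H)" using f by (simp add: arrangement_ideal_def)
  let ?M = "{\<mu> \<in> Poly_Mapping.keys f. \<forall>\<nu>\<in>Poly_Mapping.keys f. monomial_weight w \<mu> \<le> monomial_weight w \<nu>}"
  obtain N :: nat where N: "\<And>\<mu> i. \<mu> \<in> Poly_Mapping.keys f \<Longrightarrow> i \<le> m \<Longrightarrow> - int N \<le> ?e \<mu> i"
    using exponent_lower_bound[OF finite_keys] by blast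
  let ?\<beta> = "\<lambda>i. - int N"
  have "Poly_Mapping.lookup (arrangement_presentation m L' (initial_form w f)) u = 0" for u
  proof -
    let ?A = "{\<mu> \<in> Poly_Mapping.keys f. character_degree \<mu> = u}"
    let ?B = "{\<mu> \<in> ?M. character_degree \<mu> = u}"
    have "(\<Sum>\<mu>\<in>?B. mconst (Poly_Mapping.lookup f \<mu>) * power_product m L' (shifted_exponent m ?\<beta> \<mu>)) = 0"
    \<comment> \<open>In this character degree, all terms may have more than the minimal weight.\<close>
    proof (cases "?B = {}")
      case True
      show ?thesis by (simp only: True sum.empty)
    next
      case False
      then obtain \<mu>0 where \<mu>0: "\<mu>0 \<in> ?B" by blast
      define s where "s = exponent_weight m a (shifted_exponent m ?\<beta> \<mu>0)"
      have weight: "monomial_weight w \<mu> - monomial_weight w \<mu>0 = exponent_weight m a (shifted_exponent m ?\<beta> \<mu>) - s"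
        if "\<mu> \<in> ?A" for \<mu>
        unfolding s_def
        by (rule adapted_weight_shifted[OF adapted])
           (use that \<mu>0 N f_carrier in \<open>auto simp: mpoly_ring_simps\<close>)
      have "(\<Sum>\<mu>\<in>?A. mconst (Poly_Mapping.lookup f \<mu>) * power_product m L (shifted_exponent m ?\<beta> \<mu>)) = 0"
      proof -
        have "Poly_Mapping.lookup (arrangement_presentation m L f) u = 0"
          using f by (simp add: arrangement_ideal_def)
        then show ?thesis
          by (subst (asm) poly_mapping_sum_singles[of f],
              subst (asm) presentation_coefficient_eq_0_iff[where \<beta> = ?\<beta>])
             (use nonzero N in auto)
      qed
      then have "(\<Sum>\<mu> | \<mu> \<in> ?A \<and> exponent_weight m a (shifted_exponent m ?\<beta> \<mu>) = s.
          mconst (Poly_Mapping.lookup f \<mu>) * power_product m L' (shifted_exponent m ?\<beta> \<mu>)) = 0"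
      proof (rule initial_relation[rotated])
        fix \<mu> assume "\<mu> \<in> ?A"
        then show "s \<le> exponent_weight m a (shifted_exponent m ?\<beta> \<mu>)"
          using weight[of \<mu>] \<mu>0 by fastforce
      qed simp
      moreover have "{\<mu> \<in> ?A. exponent_weight m a (shifted_exponent m ?\<beta> \<mu>) = s} = ?B"
      proof (intro equalityI subsetI)
        fix \<mu> assume "\<mu> \<in> {\<mu> \<in> ?A. exponent_weight m a (shifted_exponent m ?\<beta> \<mu>) = s}"
        then show "\<mu> \<in> ?B" using weight[of \<mu>] \<mu>0 by auto
      next
        fix \<mu> assume "\<mu> \<in> ?B"
        moreover from this \<mu>0 have "monomial_weight w \<mu> = monomial_weight w \<mu>0"
          by (auto intro: order_antisym)
        ultimately show "\<mu> \<in> {\<mu> \<in> ?A. exponent_weight m a (shifted_exponent m ?\<beta> \<mu>) = s}"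
          using weight[of \<mu>] by auto
      qed
      ultimately show ?thesis by (simp only:)
    qed
    then show ?thesis
      unfolding initial_form_def
      by (subst presentation_coefficient_eq_0_iff[where \<beta> = ?\<beta>]) (use nonzero' N in auto)
  qed
  then have "arrangement_presentation m L' (initial_form w f) = 0"
    by (intro poly_mapping_eqI) simp
  then show ?thesis
    using initial_form_in_carrier[OF f_carrier] by (simp add: arrangement_ideal_def)
qed

text \<open>
  The ideal of \<open>L'\<close> is homogeneous both for the character degree and for the weight, so its elements
  decompose into parts to which \<open>homogeneous_part_in_initial_ideal\<close> applies.
\<close>

lemma degenerate_ideal_subset:
  assumes nonzero': "\<And>i. i \<le> m \<Longrightarrow> L' i \<noteq> 0"
  shows "arrangement_ideal H m L' \<subseteq> initial_ideal H w (arrangement_ideal H m L)"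
proof
  let ?J = "arrangement_ideal H m L"
  let ?e = "\<lambda>\<mu>. homogeneous_exponent m (torus_degree \<mu>)"
  fix f assume f: "f \<in> arrangement_ideal H m L'"
  let ?K = "Poly_Mapping.keys f"
  let ?\<phi> = "\<lambda>\<mu>. (character_degree \<mu>, monomial_weight w \<mu>)"
  let ?s = "\<lambda>\<mu>. Poly_Mapping.single \<mu> (Poly_Mapping.lookup f \<mu>)"
  obtain N :: nat where N: "\<And>\<mu> i. \<mu> \<in> ?K \<Longrightarrow> i \<le> m \<Longrightarrow> - int N \<le> ?e \<mu> i"
    using exponent_lower_bound[OF finite_keys] by blast
  let ?\<beta> = "\<lambda>i. - int N"
  have keys_f: "Poly_Mapping.keys \<mu> \<subseteq> H" if "\<mu> \<in> ?K" for \<mu>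
    using f that by (simp add: arrangement_ideal_def mpoly_ring_simps)
  have "(\<Sum>\<mu> | \<mu> \<in> ?K \<and> ?\<phi> \<mu> = us. ?s \<mu>) \<in> initial_ideal H w ?J" if us: "us \<in> ?\<phi> ` ?K" for us
  proof -
    obtain \<mu>0 where \<mu>0: "\<mu>0 \<in> ?K" "us = ?\<phi> \<mu>0" using us by blast
    let ?A = "{\<mu> \<in> ?K. character_degree \<mu> = fst us}"
    let ?T = "{\<mu> \<in> ?K. ?\<phi> \<mu> = us}"
    define g where "g = (\<Sum>\<mu>\<in>?T. ?s \<mu>)"
    have T: "?T \<subseteq> ?K" by blast
    have keys_g: "Poly_Mapping.keys g = ?T"
      unfolding g_def by (rule keys_sum_single_restrict[OF T])
    have lookup_g: "Poly_Mapping.lookup g \<mu> = Poly_Mapping.lookup f \<mu>" if "\<mu> \<in> ?T" for \<mu>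
      unfolding g_def lookup_sum_single_restrict[OF T] using that by simp
    have "(\<Sum>\<mu>\<in>?A. mconst (Poly_Mapping.lookup f \<mu>) * power_product m L' (shifted_exponent m ?\<beta> \<mu>)) = 0"
    proof -
      have "Poly_Mapping.lookup (arrangement_presentation m L' f) (fst us) = 0"
        using f by (simp add: arrangement_ideal_def)
      then show ?thesis
        by (subst (asm) poly_mapping_sum_singles[of f],
            subst (asm) presentation_coefficient_eq_0_iff[where \<beta> = ?\<beta>])
           (use nonzero' N in auto)
    qed
    then have "(\<Sum>\<mu> | \<mu> \<in> ?A \<and> exponent_weight m a (shifted_exponent m ?\<beta> \<mu>) =
          exponent_weight m a (shifted_exponent m ?\<beta> \<mu>0).
        mconst (Poly_Mapping.lookup f \<mu>) * power_product m L' (shifted_exponent m ?\<beta> \<mu>)) = 0"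
      by (rule graded_relation[rotated]) simp
    also have "{\<mu> \<in> ?A. exponent_weight m a (shifted_exponent m ?\<beta> \<mu>) =
          exponent_weight m a (shifted_exponent m ?\<beta> \<mu>0)} = ?T"
    proof -
      have "monomial_weight w \<mu> - monomial_weight w \<mu>0 = exponent_weight m a (shifted_exponent m ?\<beta> \<mu>) -
          exponent_weight m a (shifted_exponent m ?\<beta> \<mu>0)" if "\<mu> \<in> ?A" for \<mu>
        by (rule adapted_weight_shifted[OF adapted]) (use that \<mu>0 N keys_f in auto)
      then show ?thesis using \<mu>0(2) by fastforce
    qed
    finally have zero_N: "(\<Sum>\<mu>\<in>?T. mconst (Poly_Mapping.lookup f \<mu>) *
        power_product m L' (shifted_exponent m ?\<beta> \<mu>)) = 0" .
    \<comment> \<open>The uniform bounds \<open>- N\<close> used so far serve all of \<open>f\<close> but need not be admissible;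
      the exact minima are.\<close>
    define \<beta> where "\<beta> i = Min ((\<lambda>\<mu>. ?e \<mu> i) ` ?T)" for i
    have \<beta>_le: "\<beta> i \<le> ?e \<mu> i" if "\<mu> \<in> ?T" for \<mu> i
      unfolding \<beta>_def using that by (intro Min_le) auto
    have "admissible (fst us) \<beta>"
      unfolding admissible_def
    proof (intro allI impI)
      fix i
      have "\<beta> i \<in> (\<lambda>\<mu>. ?e \<mu> i) ` ?T"
        unfolding \<beta>_def using \<mu>0 by (intro Min_in) auto
      then obtain \<mu> where \<mu>: "\<mu> \<in> ?T" "\<beta> i = ?e \<mu> i" by blast
      then have "(torus_degree \<mu>, fst us) \<in> S"
        using degree_in_monoid[OF keys_f, of \<mu>] by auto
      then show "\<exists>h. (h, fst us) \<in> S \<and> homogeneous_exponent m h i \<le> \<beta> i"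
        using \<mu>(2) by auto
    qed
    moreover have "(\<Sum>\<mu>\<in>?T. mconst (Poly_Mapping.lookup f \<mu>) * power_product m L' (shifted_exponent m \<beta> \<mu>)) = 0"
    proof -
      have same: "{\<mu> \<in> ?T. character_degree \<mu> = fst us} = ?T" by auto
      have "Poly_Mapping.lookup (arrangement_presentation m L' g) (fst us) = 0"
        unfolding g_def
        by (subst presentation_coefficient_eq_0_iff[where \<beta> = ?\<beta>])
           (use nonzero' N zero_N same in auto)
      then show ?thesis
        unfolding g_def
        by (subst (asm) presentation_coefficient_eq_0_iff[where \<beta> = \<beta>])
           (use nonzero' \<beta>_le same in auto)
    qed
    moreover have "g \<in> carrier (mpoly_ring H)"
      unfolding g_def by (intro carrier_sum carrier_single keys_f) simp
    ultimately have "g \<in> initial_ideal H w ?J"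
      by (intro homogeneous_part_in_initial_ideal[where u = "fst us" and \<beta> = \<beta> and s = "snd us"])
         (auto simp: keys_g lookup_g \<beta>_le simp flip: \<mu>0(2))
    then show ?thesis unfolding g_def .
  qed
  moreover have "f = (\<Sum>us\<in>?\<phi> ` ?K. \<Sum>\<mu> | \<mu> \<in> ?K \<and> ?\<phi> \<mu> = us. ?s \<mu>)"
    by (subst sum.image_gen[symmetric]) (simp_all flip: poly_mapping_sum_singles)
  moreover have "ideal (initial_ideal H w ?J) (mpoly_ring H)"
    by (rule ideal_initial_ideal) (auto simp: arrangement_ideal_def)
  ultimately show "f \<in> initial_ideal H w ?J"
    using ideal_sum_closed by (metis (no_types, lifting))
qed

end

text \<open>
  For trivial weights \<open>a\<close> the degenerate forms are nonzero because the given ones are; otherwise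
  there are admissible bounds of sum \<open>- 1\<close>.
\<close>

lemma (in box_closed_monoid) primeideal_initial_ideal:
  assumes forms: "\<And>i. i \<le> m \<Longrightarrow> L i \<in> hom_polys c 1" and nonzero: "\<And>i. i \<le> m \<Longrightarrow> L i \<noteq> 0"
    and trop: "w \<in> Trop H (arrangement_ideal H m L)"
  shows "primeideal (initial_ideal H w (arrangement_ideal H m L)) (mpoly_ring H)"
proof -
  have "monomial_weight w \<mu> = monomial_weight w \<nu>"
    if "Poly_Mapping.keys \<mu> \<subseteq> H" "Poly_Mapping.keys \<nu> \<subseteq> H" "monomial_degree \<mu> = monomial_degree \<nu>" for \<mu> \<nu>
    using weight_factors_through_degree[OF trop nonzero] that by (metis order_antisym)
  then obtain a where adapted: "adapted w a"
    and a: "(\<forall>i. a i = 0) \<or> (\<exists>u \<beta>. admissible u \<beta> \<and> (\<Sum>i\<le>m. \<beta> i) = - 1)"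
    using adapted_if_degree_weight by metis
  obtain L' where "linear_degeneration m a L L'"
    using exists_linear_degeneration[where a = a and L = L and m = m] forms by blast
  then interpret linear_degeneration m a L L' .
  interpret arrangement_degeneration m H S a L L' w
    by unfold_locales (use nonzero adapted in auto)
  have nonzero': "L' i \<noteq> 0" if "i \<le> m" for i
    using a trivial_weight nonzero degenerate_form_nonzero[OF trop] that by blast
  have "initial_ideal H w (arrangement_ideal H m L) = arrangement_ideal H m L'"
  proof
    show "initial_ideal H w (arrangement_ideal H m L) \<subseteq> arrangement_ideal H m L'"
    proof (rule initial_ideal_minimal)
      show "ideal (arrangement_ideal H m L') (mpoly_ring H)"
        using primeideal_arrangement_ideal by (rule primeideal.axioms)
    qed (rule initial_form_in_degenerate_ideal[OF nonzero'])
    show "arrangement_ideal H m L' \<subseteq> initial_ideal H w (arrangement_ideal H m L)"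
      using nonzero' by (rule degenerate_ideal_subset)
  qed
  then show ?thesis using primeideal_arrangement_ideal by simp
qed

section \<open>Semi-canonical embeddings\<close>

lemma pairing_superset:
  assumes "finite A" "Poly_Mapping.keys u \<subseteq> A"
  shows "pairing u v = (\<Sum>j\<in>A. of_int (Poly_Mapping.lookup u j) * Poly_Mapping.lookup v j)"
  unfolding pairing_def
  by (rule sum.mono_neutral_left) (use assms in \<open>auto simp: in_keys_iff\<close>)

lemma pairing_add_right: "pairing u (v + v') = pairing u v + pairing u v'"
  by (simp add: pairing_def lookup_add distrib_left sum.distrib)

lemma lookup_scaleR: "Poly_Mapping.lookup (r *\<^sub>R v) i = r * Poly_Mapping.lookup (v :: real_vec) i"
proof -
  have "finite {i. r * Poly_Mapping.lookup v i \<noteq> 0}"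
    by (rule finite_subset[OF _ finite_keys[of v]]) (auto simp: in_keys_iff)
  then show ?thesis by (simp add: scaleR_poly_mapping_def)
qed

lemma pairing_scaleR_right: "pairing u (r *\<^sub>R v) = r * pairing u v"
  by (simp add: pairing_def lookup_scaleR sum_distrib_left mult_ac)

lemma pairing_ray:
  assumes "Poly_Mapping.keys h \<subseteq> {1..m}" "i \<le> m"
  shows "pairing h (ray m i) = of_int (homogeneous_exponent m h i)"
proof -
  have "pairing h (ray m i) = (\<Sum>j=1..m. of_int (Poly_Mapping.lookup h j) * Poly_Mapping.lookup (ray m i) j)"
    by (rule pairing_superset) (use assms in auto)
  also have "\<dots> = of_int (homogeneous_exponent m h i)"
    using assms(2)
    by (auto simp: ray_def homogeneous_exponent_def lookup_sum lookup_single when_def sum_negf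
        if_distrib[where f = "(*) x" for x] simp del: One_nat_def cong: if_cong)
  finally show ?thesis .
qed

text \<open>
  Nonnegativity on a cone is tested on its generators; on the generators \<open>(e\<^sub>i, v)\<close> it is a lower bound
  for the homogeneous exponent with index \<open>i\<close> alone.
\<close>

lemma in_dual_delta_lattice_iff:
  "(h, u) \<in> dual_delta_lattice m n (delta_cone m \<sigma> \<Delta>) \<longleftrightarrow>
    Poly_Mapping.keys h \<subseteq> {1..m} \<and> Poly_Mapping.keys u \<subseteq> {..<n} \<and>
    (\<forall>v\<in>\<sigma>. 0 \<le> pairing u v) \<and>
    (\<forall>i\<le>m. \<forall>v\<in>\<Delta> i. 0 \<le> of_int (homogeneous_exponent m h i) + pairing u v)"
  (is "?lhs \<longleftrightarrow> ?rhs")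
proof
  assume ?lhs
  then have keys: "Poly_Mapping.keys h \<subseteq> {1..m}" "Poly_Mapping.keys u \<subseteq> {..<n}"
    and nonneg: "\<And>x. x \<in> delta_cone m \<sigma> \<Delta> \<Longrightarrow> 0 \<le> pairing h (fst x) + pairing u (snd x)"
    by (auto simp: dual_delta_lattice_def)
  have generators: "{0} \<times> \<sigma> \<union> (\<Union>i\<le>m. {ray m i} \<times> \<Delta> i) \<subseteq> delta_cone m \<sigma> \<Delta>"
    unfolding delta_cone_def by (rule hull_subset)
  have "0 \<le> pairing u v" if "v \<in> \<sigma>" for v
    using nonneg[of "(0, v)"] generators that by (auto simp: pairing_def)
  moreover have "0 \<le> of_int (homogeneous_exponent m h i) + pairing u v" if "i \<le> m" "v \<in> \<Delta> i" for i v
  proof -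
    have "(ray m i, v) \<in> delta_cone m \<sigma> \<Delta>" using generators that by blast
    then show ?thesis using nonneg[of "(ray m i, v)"] pairing_ray[OF keys(1) that(1)] by simp
  qed
  ultimately show ?rhs using keys by blast
next
  assume r: ?rhs
  let ?P = "{x. 0 \<le> pairing h (fst x) + pairing u (snd x)}"
  have "delta_cone m \<sigma> \<Delta> \<subseteq> ?P"
    unfolding delta_cone_def
  proof (rule hull_minimal)
    show "{0} \<times> \<sigma> \<union> (\<Union>i\<le>m. {ray m i} \<times> \<Delta> i) \<subseteq> ?P"
      using r pairing_ray[of h m] by (auto simp: pairing_def[of h 0])
    show "convex_cone ?P"
      unfolding convex_cone_def convex_def conic_def
    proof (intro conjI ballI allI impI)
      have "0 \<in> ?P" by (simp add: pairing_def)
      then show "?P \<noteq> {}" by blast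
    next
      fix x y r t assume "x \<in> ?P" "y \<in> ?P" "0 \<le> (r :: real)" "0 \<le> (t :: real)"
      then have "0 \<le> r * (pairing h (fst x) + pairing u (snd x)) + t * (pairing h (fst y) + pairing u (snd y))"
        by simp
      then show "r *\<^sub>R x + t *\<^sub>R y \<in> ?P"
        by (simp add: pairing_add_right pairing_scaleR_right distrib_left)
    next
      fix x r assume "x \<in> ?P" "0 \<le> (r :: real)"
      then have "0 \<le> r * (pairing h (fst x) + pairing u (snd x))" by simp
      then show "r *\<^sub>R x \<in> ?P"
        by (simp add: pairing_scaleR_right distrib_left)
    qed
  qed
  then show ?lhs using r by (auto simp: dual_delta_lattice_def)
qed

theorem theorem1p5:
  fixes n c m :: nat
    and \<sigma> :: "real_vec set"
    and \<Delta> :: "nat \<Rightarrow> real_vec set"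
    and L :: "nat \<Rightarrow> nat mpoly"
    and H :: "(lattice_vec \<times> lattice_vec) set"
  assumes cone: "pointed_rational_cone n \<sigma>"
    and forms: "full_rank_forms c m L"
    and polyhedra: "\<And>i. i \<le> m \<Longrightarrow> sigma_polyhedron n \<sigma> (\<Delta> i)"
    and proper: "(\<Sum>i\<le>m. \<Delta> i) \<subset> \<sigma>"
    and basis: "hilbert_basis H (dual_delta_lattice m n (delta_cone m \<sigma> \<Delta>))"
  shows "well_poised H (semi_canonical_ideal n \<sigma> c m L \<Delta> H)"
proof -
  let ?S = "dual_delta_lattice m n (delta_cone m \<sigma> \<Delta>)"
  have L: "L i \<in> hom_polys c 1" "L i \<noteq> 0" if "i \<le> m" for i
    using forms that by (auto simp: full_rank_forms_def)
  interpret box_closed_monoid m H ?S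
  proof
    show "?S = monomial_degree ` {\<mu>. Poly_Mapping.keys \<mu> \<subseteq> H}"
      using basis by (simp add: hilbert_basis_def hull_eq_monomial_degrees)
    show "Poly_Mapping.keys h \<subseteq> {1..m}" if "(h, u) \<in> ?S" for h u
      using that by (simp add: dual_delta_lattice_def)
    show "(h, u) \<in> ?S"
      if h: "Poly_Mapping.keys h \<subseteq> {1..m}"
        and below: "\<And>i. i \<le> m \<Longrightarrow> \<exists>h'. (h', u) \<in> ?S \<and> homogeneous_exponent m h' i \<le> homogeneous_exponent m h i"
      for h u
      unfolding in_dual_delta_lattice_iff
    proof (intro conjI allI impI ballI)
      show "Poly_Mapping.keys h \<subseteq> {1..m}" by (rule h)
      show "Poly_Mapping.keys u \<subseteq> {..<n}"
        using below[of 0] unfolding in_dual_delta_lattice_iff by auto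
      show "0 \<le> pairing u v" if "v \<in> \<sigma>" for v
        using below[of 0] that unfolding in_dual_delta_lattice_iff by auto
      fix i v assume "i \<le> m" "v \<in> \<Delta> i"
      moreover from below[OF \<open>i \<le> m\<close>] obtain h' where "(h', u) \<in> ?S"
        "homogeneous_exponent m h' i \<le> homogeneous_exponent m h i" by blast
      ultimately show "0 \<le> of_int (homogeneous_exponent m h i) + pairing u v"
        unfolding in_dual_delta_lattice_iff by (smt (verit) of_int_le_iff)
    qed
  qed
  have "semi_canonical_ideal n \<sigma> c m L \<Delta> H = arrangement_ideal H m L"
    by (rule semi_canonical_ideal_eq) (rule L(2))
  moreover have "mvar v \<notin> arrangement_ideal H m L" for v
    by (rule mvar_notin_arrangement_ideal) (rule L(2))
  moreover have "primeideal (initial_ideal H w (arrangement_ideal H m L)) (mpoly_ring H)"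
    if "w \<in> Trop H (arrangement_ideal H m L)" for w
    using L that by (rule primeideal_initial_ideal)
  ultimately show ?thesis
    unfolding well_poised_def using primeideal_arrangement_ideal by simp
qed

end
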